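(* Let $F\dashv U$, with $U\colon \mathsf{U}\to\mathsf{V}$ and $F\colon\mathsf{V}\to\mathsf{U}$, be an ideally exact context. Let $B$ be an object of $\mathsf{U}$, $X$ an object of $\mathsf{V}$, and let $\xi\colon U(B)\flat X\to X$ be a relative $U$-action. If $\xi$ is ideal, then $\xi$ is coherent.
   Context: A category is semi-abelian if it is pointed, protomodular, Barr-exact and has finite coproducts. A category is ideally exact if it is Barr-exact, protomodular, has finite coproducts, and the unique morphism from its initial object to its terminal object is a regular epimorphism. An ideally exact context is a monadic adjunction $F\dashv U$, $U\colon\mathsf{U}\to\mathsf{V}$, with $\mathsf{U}$ ideally exact, $\mathsf{V}$ semi-abelian, and cartesian unit $\eta$ (all naturality squares of $\eta$ are pullbacks). Then $F(0)$ is initial in $\mathsf{U}$ (where $0$ is the zero object of $\mathsf{V}$). Write $\iota_B\colon F(0)\to B$ for the unique morphism in $\mathsf{U}$, and $\tau_X\colon X\to 0$, $\iota_X\colon 0\to X$ for the unique morphisms in $\mathsf{V}$. Internal actions in $\mathsf{V}$: for objects $C,X$ of $\mathsf{V}$, $\kappa_{C,X}\colon C\flat X\to C+X$ denotes a kernel of $[\mathrm{id}_C,0]\colon C+X\to C$. The functor $C\flat(-)$ is a monad on $\mathsf{V}$ (unit $u_X$ with $\kappa_{C,X}u_X=i_2$, multiplication $\mu_X$ with $\kappa_{C,X}\mu_X=[i_1,\kappa_{C,X}]\kappa_{C,C\flat X}$), and an internal action of $C$ on $X$ is a $C\flat(-)$-algebra structure $\xi\colon C\flat X\to X$. For $g\colon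 C\to D$, $g\flat\mathrm{id}_X\colon C\flat X\to D\flat X$ is the unique morphism with $\kappa_{D,X}(g\flat\mathrm{id}_X)=(g+\mathrm{id}_X)\kappa_{C,X}$. A split epimorphism $p\colon A\to C$ with chosen section $s$ is associated with $\xi$ if there is a kernel $k\colon X\to A$ of $p$ with $k\xi=[s,k]\kappa_{C,X}$; this gives an equivalence between the category $\mathrm{Pt}_{\mathsf{V}}(C)$ of split epimorphisms over $C$ with chosen section and the category of $C\flat(-)$-algebras. A relative $U$-action of $B\in\mathsf{U}$ on $X\in\mathsf{V}$ is an internal action $\xi\colon U(B)\flat X\to X$ in $\mathsf{V}$. The action $\xi_0\colon UF(0)\flat X\to X$ is the one associated with the split epimorphism $UF(\tau_X)\colon UF(X)\to UF(0)$ with section $UF(\iota_X)$ and kernel $\eta_X$, i.e. $\eta_X\xi_0=[UF(\iota_X),\eta_X]\kappa_{UF(0),X}$. The relative $U$-action $\xi$ is coherent if $\xi\circ(U(\iota_B)\flat\mathrm{id}_X)=\xi_0$. A split epimorphism $p\colon A\to U(B)$ with section $s$ in $\mathsf{V}$ is ideal if there exist a split epimorphism $p'\colon A'\to B$ with section $s'$ in $\mathsf{U}$ and an isomorphism $\sigma\colon U(A')\to A$ with $p\sigma=U(p')$ and $\sigma U(s')=s$. The relative $U$-action $\xi$ is ideal if any split epimorphism associated with it is ideal. *)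

theory Defs
  imports Main
begin

section \<open>Categories\<close>

text \<open>
  Categories are carrier-based. \<open>g \<cdot>\<^bsub>C\<^esub> f\<close> is the composite "first \<open>f\<close>, then \<open>g\<close>"; it is
  meaningful only if \<open>Cod C f = Dom C g\<close>.
\<close>

record ('o, 'm) cat =
  Obj :: "'o set"
  Arr :: "'m set"
  Dom :: "'m \<Rightarrow> 'o"
  Cod :: "'m \<Rightarrow> 'o"
  Idn :: "'o \<Rightarrow> 'm"
  Cmp :: "'m \<Rightarrow> 'm \<Rightarrow> 'm"  (infixr "\<cdot>\<index>" 70)

definition Hom :: "('o, 'm) cat \<Rightarrow> 'o \<Rightarrow> 'o \<Rightarrow> 'm set" where
  "Hom C a b = {f \<in> Arr C. Dom C f = a \<and> Cod C f = b}"

definition is_category :: "('o, 'm) cat \<Rightarrow> bool" where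
  "is_category C \<longleftrightarrow>
     (\<forall>f\<in>Arr C. Dom C f \<in> Obj C \<and> Cod C f \<in> Obj C) \<and>
     (\<forall>a\<in>Obj C. Idn C a \<in> Hom C a a) \<and>
     (\<forall>f\<in>Arr C. \<forall>g\<in>Arr C. Cod C f = Dom C g \<longrightarrow> g \<cdot>\<^bsub>C\<^esub> f \<in> Hom C (Dom C f) (Cod C g)) \<and>
     (\<forall>f\<in>Arr C. f \<cdot>\<^bsub>C\<^esub> Idn C (Dom C f) = f \<and> Idn C (Cod C f) \<cdot>\<^bsub>C\<^esub> f = f) \<and>
     (\<forall>f\<in>Arr C. \<forall>g\<in>Arr C. \<forall>h\<in>Arr C. Cod C f = Dom C g \<longrightarrow> Cod C g = Dom C h \<longrightarrow>
        h \<cdot>\<^bsub>C\<^esub> (g \<cdot>\<^bsub>C\<^esub> f) = (h \<cdot>\<^bsub>C\<^esub> g) \<cdot>\<^bsub>C\<^esub> f)"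

definition is_iso :: "('o, 'm) cat \<Rightarrow> 'm \<Rightarrow> bool" where
  "is_iso C f \<longleftrightarrow> f \<in> Arr C \<and>
     (\<exists>g\<in>Hom C (Cod C f) (Dom C f). g \<cdot>\<^bsub>C\<^esub> f = Idn C (Dom C f) \<and> f \<cdot>\<^bsub>C\<^esub> g = Idn C (Cod C f))"

subsection \<open>Limits and colimits\<close>

definition is_initial :: "('o, 'm) cat \<Rightarrow> 'o \<Rightarrow> bool" where
  "is_initial C z \<longleftrightarrow> z \<in> Obj C \<and> (\<forall>a\<in>Obj C. \<exists>!f. f \<in> Hom C z a)"

definition is_terminal :: "('o, 'm) cat \<Rightarrow> 'o \<Rightarrow> bool" where
  "is_terminal C t \<longleftrightarrow> t \<in> Obj C \<and> (\<forall>a\<in>Obj C. \<exists>!f. f \<in> Hom C a t)"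

definition is_zero_object :: "('o, 'm) cat \<Rightarrow> 'o \<Rightarrow> bool" where
  "is_zero_object C z \<longleftrightarrow> is_initial C z \<and> is_terminal C z"

definition pointed :: "('o, 'm) cat \<Rightarrow> bool" where
  "pointed C \<longleftrightarrow> (\<exists>z. is_zero_object C z)"

text \<open>The unique morphism from \<open>a\<close> to \<open>b\<close>; used only when \<open>a\<close> is initial or \<open>b\<close> is terminal.\<close>

definition the_mor :: "('o, 'm) cat \<Rightarrow> 'o \<Rightarrow> 'o \<Rightarrow> 'm" where
  "the_mor C a b = (THE f. f \<in> Hom C a b)"

definition zero_mor :: "('o, 'm) cat \<Rightarrow> 'o \<Rightarrow> 'o \<Rightarrow> 'm" where
  "zero_mor C a b =
     (THE f. \<exists>z g h. is_zero_object C z \<and> g \<in> Hom C a z \<and> h \<in> Hom C z b \<and> f = h \<cdot>\<^bsub>C\<^esub> g)"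

definition is_coproduct :: "('o, 'm) cat \<Rightarrow> 'o \<Rightarrow> 'o \<Rightarrow> 'm \<Rightarrow> 'm \<Rightarrow> bool" where
  "is_coproduct C a b i j \<longleftrightarrow>
     i \<in> Hom C a (Cod C i) \<and> j \<in> Hom C b (Cod C i) \<and>
     (\<forall>x\<in>Obj C. \<forall>f\<in>Hom C a x. \<forall>g\<in>Hom C b x.
        \<exists>!h. h \<in> Hom C (Cod C i) x \<and> h \<cdot>\<^bsub>C\<^esub> i = f \<and> h \<cdot>\<^bsub>C\<^esub> j = g)"

definition has_finite_coproducts :: "('o, 'm) cat \<Rightarrow> bool" where
  "has_finite_coproducts C \<longleftrightarrow>
     (\<exists>z. is_initial C z) \<and> (\<forall>a\<in>Obj C. \<forall>b\<in>Obj C. \<exists>i j. is_coproduct C a b i j)"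

text \<open>
  \<open>is_pullback C f g p q\<close>: the square \<open>f \<cdot> p = g \<cdot> q\<close> is a pullback of the cospan \<open>f, g\<close>.
\<close>

definition is_pullback :: "('o, 'm) cat \<Rightarrow> 'm \<Rightarrow> 'm \<Rightarrow> 'm \<Rightarrow> 'm \<Rightarrow> bool" where
  "is_pullback C f g p q \<longleftrightarrow>
     f \<in> Arr C \<and> g \<in> Arr C \<and> Cod C f = Cod C g \<and>
     p \<in> Hom C (Dom C p) (Dom C f) \<and> q \<in> Hom C (Dom C p) (Dom C g) \<and>
     f \<cdot>\<^bsub>C\<^esub> p = g \<cdot>\<^bsub>C\<^esub> q \<and>
     (\<forall>x\<in>Obj C. \<forall>u\<in>Hom C x (Dom C f). \<forall>v\<in>Hom C x (Dom C g). f \<cdot>\<^bsub>C\<^esub> u = g \<cdot>\<^bsub>C\<^esub> v \<longrightarrow>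
        (\<exists>!h. h \<in> Hom C x (Dom C p) \<and> p \<cdot>\<^bsub>C\<^esub> h = u \<and> q \<cdot>\<^bsub>C\<^esub> h = v))"

definition has_finite_limits :: "('o, 'm) cat \<Rightarrow> bool" where
  "has_finite_limits C \<longleftrightarrow>
     (\<exists>t. is_terminal C t) \<and>
     (\<forall>f\<in>Arr C. \<forall>g\<in>Arr C. Cod C f = Cod C g \<longrightarrow> (\<exists>p q. is_pullback C f g p q))"

definition is_coequalizer :: "('o, 'm) cat \<Rightarrow> 'm \<Rightarrow> 'm \<Rightarrow> 'm \<Rightarrow> bool" where
  "is_coequalizer C f g e \<longleftrightarrow>
     f \<in> Arr C \<and> g \<in> Hom C (Dom C f) (Cod C f) \<and> e \<in> Hom C (Cod C f) (Cod C e) \<and>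
     e \<cdot>\<^bsub>C\<^esub> f = e \<cdot>\<^bsub>C\<^esub> g \<and>
     (\<forall>x\<in>Obj C. \<forall>u\<in>Hom C (Cod C f) x. u \<cdot>\<^bsub>C\<^esub> f = u \<cdot>\<^bsub>C\<^esub> g \<longrightarrow>
        (\<exists>!h. h \<in> Hom C (Cod C e) x \<and> h \<cdot>\<^bsub>C\<^esub> e = u))"

definition is_regular_epi :: "('o, 'm) cat \<Rightarrow> 'm \<Rightarrow> bool" where
  "is_regular_epi C e \<longleftrightarrow> (\<exists>f g. is_coequalizer C f g e)"

definition is_kernel :: "('o, 'm) cat \<Rightarrow> 'm \<Rightarrow> 'm \<Rightarrow> bool" where
  "is_kernel C k f \<longleftrightarrow>
     f \<in> Arr C \<and> k \<in> Hom C (Dom C k) (Dom C f) \<and>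
     f \<cdot>\<^bsub>C\<^esub> k = zero_mor C (Dom C k) (Cod C f) \<and>
     (\<forall>x\<in>Obj C. \<forall>u\<in>Hom C x (Dom C f). f \<cdot>\<^bsub>C\<^esub> u = zero_mor C x (Cod C f) \<longrightarrow>
        (\<exists>!h. h \<in> Hom C x (Dom C k) \<and> k \<cdot>\<^bsub>C\<^esub> h = u))"

subsection \<open>Exactness and protomodularity\<close>

definition is_kernel_pair :: "('o, 'm) cat \<Rightarrow> 'm \<Rightarrow> 'm \<Rightarrow> 'm \<Rightarrow> bool" where
  "is_kernel_pair C f r1 r2 \<longleftrightarrow> is_pullback C f f r1 r2"

definition regular_category :: "('o, 'm) cat \<Rightarrow> bool" where
  "regular_category C \<longleftrightarrow>
     is_category C \<and> has_finite_limits C \<and>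
     (\<forall>f r1 r2. is_kernel_pair C f r1 r2 \<longrightarrow> (\<exists>e. is_coequalizer C r1 r2 e)) \<and>
     (\<forall>e g p q. is_pullback C e g p q \<longrightarrow> is_regular_epi C e \<longrightarrow> is_regular_epi C q)"

definition is_equivalence_relation :: "('o, 'm) cat \<Rightarrow> 'm \<Rightarrow> 'm \<Rightarrow> bool" where
  "is_equivalence_relation C r1 r2 \<longleftrightarrow>
     r1 \<in> Arr C \<and> r2 \<in> Hom C (Dom C r1) (Cod C r1) \<and>
     (\<forall>x\<in>Obj C. \<forall>u\<in>Hom C x (Dom C r1). \<forall>v\<in>Hom C x (Dom C r1).
        r1 \<cdot>\<^bsub>C\<^esub> u = r1 \<cdot>\<^bsub>C\<^esub> v \<longrightarrow> r2 \<cdot>\<^bsub>C\<^esub> u = r2 \<cdot>\<^bsub>C\<^esub> v \<longrightarrow> u = v) \<and>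
     (\<exists>d\<in>Hom C (Cod C r1) (Dom C r1).
        r1 \<cdot>\<^bsub>C\<^esub> d = Idn C (Cod C r1) \<and> r2 \<cdot>\<^bsub>C\<^esub> d = Idn C (Cod C r1)) \<and>
     (\<exists>s\<in>Hom C (Dom C r1) (Dom C r1). r1 \<cdot>\<^bsub>C\<^esub> s = r2 \<and> r2 \<cdot>\<^bsub>C\<^esub> s = r1) \<and>
     (\<forall>p q. is_pullback C r2 r1 p q \<longrightarrow>
        (\<exists>t\<in>Hom C (Dom C p) (Dom C r1). r1 \<cdot>\<^bsub>C\<^esub> t = r1 \<cdot>\<^bsub>C\<^esub> p \<and> r2 \<cdot>\<^bsub>C\<^esub> t = r2 \<cdot>\<^bsub>C\<^esub> q))"

definition barr_exact :: "('o, 'm) cat \<Rightarrow> bool" where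
  "barr_exact C \<longleftrightarrow>
     regular_category C \<and>
     (\<forall>r1 r2. is_equivalence_relation C r1 r2 \<longrightarrow> (\<exists>f. is_kernel_pair C f r1 r2))"

text \<open>\<open>is_point C a b p s\<close>: \<open>p : a \<rightarrow> b\<close> is a split epimorphism with chosen section \<open>s\<close>.\<close>

definition is_point :: "('o, 'm) cat \<Rightarrow> 'o \<Rightarrow> 'o \<Rightarrow> 'm \<Rightarrow> 'm \<Rightarrow> bool" where
  "is_point C a b p s \<longleftrightarrow> p \<in> Hom C a b \<and> s \<in> Hom C b a \<and> p \<cdot>\<^bsub>C\<^esub> s = Idn C b"

text \<open>
  Protomodularity: for each \<open>v : b \<rightarrow> c\<close>, the change-of-base functor from points over \<open>c\<close> to points
  over \<open>b\<close> reflects isomorphisms. Here \<open>f\<close> is a morphism of points over \<open>c\<close> and \<open>h\<close> is its image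
  under change of base, computed with arbitrary pullbacks of \<open>p\<close> and \<open>p'\<close> along \<open>v\<close>.
\<close>

definition protomodular :: "('o, 'm) cat \<Rightarrow> bool" where
  "protomodular C \<longleftrightarrow>
     is_category C \<and> has_finite_limits C \<and>
     (\<forall>a a' b c p s p' s' f v x q x' q' h.
        is_point C a c p s \<longrightarrow> is_point C a' c p' s' \<longrightarrow>
        f \<in> Hom C a a' \<longrightarrow> p' \<cdot>\<^bsub>C\<^esub> f = p \<longrightarrow> f \<cdot>\<^bsub>C\<^esub> s = s' \<longrightarrow>
        v \<in> Hom C b c \<longrightarrow> is_pullback C p v x q \<longrightarrow> is_pullback C p' v x' q' \<longrightarrow>
        h \<in> Hom C (Dom C x) (Dom C x') \<longrightarrow> x' \<cdot>\<^bsub>C\<^esub> h = f \<cdot>\<^bsub>C\<^esub> x \<longrightarrow> q' \<cdot>\<^bsub>C\<^esub> h = q \<longrightarrow>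
        is_iso C h \<longrightarrow> is_iso C f)"

definition semi_abelian :: "('o, 'm) cat \<Rightarrow> bool" where
  "semi_abelian C \<longleftrightarrow> pointed C \<and> protomodular C \<and> barr_exact C \<and> has_finite_coproducts C"

definition ideally_exact :: "('o, 'm) cat \<Rightarrow> bool" where
  "ideally_exact C \<longleftrightarrow>
     barr_exact C \<and> protomodular C \<and> has_finite_coproducts C \<and>
     (\<forall>z t. is_initial C z \<longrightarrow> is_terminal C t \<longrightarrow> is_regular_epi C (the_mor C z t))"

section \<open>Functors, monads and monadic adjunctions\<close>

record ('o1, 'm1, 'o2, 'm2) ftor =
  FO :: "'o1 \<Rightarrow> 'o2"
  FM :: "'m1 \<Rightarrow> 'm2"

definition is_ftor :: "('o1, 'm1) cat \<Rightarrow> ('o2, 'm2) cat \<Rightarrow> ('o1, 'm1, 'o2, 'm2) ftor \<Rightarrow> bool" where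
  "is_ftor C D F \<longleftrightarrow>
     (\<forall>a\<in>Obj C. FO F a \<in> Obj D \<and> FM F (Idn C a) = Idn D (FO F a)) \<and>
     (\<forall>f\<in>Arr C. FM F f \<in> Hom D (FO F (Dom C f)) (FO F (Cod C f))) \<and>
     (\<forall>f\<in>Arr C. \<forall>g\<in>Arr C. Cod C f = Dom C g \<longrightarrow> FM F (g \<cdot>\<^bsub>C\<^esub> f) = FM F g \<cdot>\<^bsub>D\<^esub> FM F f)"

definition id_ftor :: "('o, 'm, 'o, 'm) ftor" where
  "id_ftor = \<lparr>FO = (\<lambda>a. a), FM = (\<lambda>f. f)\<rparr>"

definition comp_ftor ::
  "('o2, 'm2, 'o3, 'm3) ftor \<Rightarrow> ('o1, 'm1, 'o2, 'm2) ftor \<Rightarrow> ('o1, 'm1, 'o3, 'm3) ftor"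
where
  "comp_ftor G F = \<lparr>FO = (\<lambda>a. FO G (FO F a)), FM = (\<lambda>f. FM G (FM F f))\<rparr>"

definition is_nat_trans ::
  "('o1, 'm1) cat \<Rightarrow> ('o2, 'm2) cat \<Rightarrow> ('o1, 'm1, 'o2, 'm2) ftor \<Rightarrow> ('o1, 'm1, 'o2, 'm2) ftor \<Rightarrow>
   ('o1 \<Rightarrow> 'm2) \<Rightarrow> bool"
where
  "is_nat_trans C D F G t \<longleftrightarrow>
     (\<forall>a\<in>Obj C. t a \<in> Hom D (FO F a) (FO G a)) \<and>
     (\<forall>f\<in>Arr C. FM G f \<cdot>\<^bsub>D\<^esub> t (Dom C f) = t (Cod C f) \<cdot>\<^bsub>D\<^esub> FM F f)"

definition nat_isomorphic ::
  "('o1, 'm1) cat \<Rightarrow> ('o2, 'm2) cat \<Rightarrow> ('o1, 'm1, 'o2, 'm2) ftor \<Rightarrow> ('o1, 'm1, 'o2, 'm2) ftor \<Rightarrow> bool"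
where
  "nat_isomorphic C D F G \<longleftrightarrow> (\<exists>t. is_nat_trans C D F G t \<and> (\<forall>a\<in>Obj C. is_iso D (t a)))"

definition is_equivalence ::
  "('o1, 'm1) cat \<Rightarrow> ('o2, 'm2) cat \<Rightarrow> ('o1, 'm1, 'o2, 'm2) ftor \<Rightarrow> bool"
where
  "is_equivalence C D K \<longleftrightarrow>
     is_ftor C D K \<and>
     (\<exists>G. is_ftor D C G \<and> nat_isomorphic C C id_ftor (comp_ftor G K) \<and>
          nat_isomorphic D D (comp_ftor K G) id_ftor)"

definition is_adjunction ::
  "('o1, 'm1) cat \<Rightarrow> ('o2, 'm2) cat \<Rightarrow> ('o2, 'm2, 'o1, 'm1) ftor \<Rightarrow> ('o1, 'm1, 'o2, 'm2) ftor \<Rightarrow>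
   ('o2 \<Rightarrow> 'm2) \<Rightarrow> ('o1 \<Rightarrow> 'm1) \<Rightarrow> bool"
where
  "is_adjunction UU VV F U \<eta> \<epsilon> \<longleftrightarrow>
     is_category UU \<and> is_category VV \<and> is_ftor VV UU F \<and> is_ftor UU VV U \<and>
     is_nat_trans VV VV id_ftor (comp_ftor U F) \<eta> \<and>
     is_nat_trans UU UU (comp_ftor F U) id_ftor \<epsilon> \<and>
     (\<forall>x\<in>Obj VV. \<epsilon> (FO F x) \<cdot>\<^bsub>UU\<^esub> FM F (\<eta> x) = Idn UU (FO F x)) \<and>
     (\<forall>b\<in>Obj UU. FM U (\<epsilon> b) \<cdot>\<^bsub>VV\<^esub> \<eta> (FO U b) = Idn VV (FO U b))"

definition is_algebra ::
  "('o, 'm) cat \<Rightarrow> ('o, 'm, 'o, 'm) ftor \<Rightarrow> ('o \<Rightarrow> 'm) \<Rightarrow> ('o \<Rightarrow> 'm) \<Rightarrow> 'o \<Rightarrow> 'm \<Rightarrow> bool"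
where
  "is_algebra C T \<eta> \<mu> x h \<longleftrightarrow>
     x \<in> Obj C \<and> h \<in> Hom C (FO T x) x \<and>
     h \<cdot>\<^bsub>C\<^esub> \<eta> x = Idn C x \<and> h \<cdot>\<^bsub>C\<^esub> FM T h = h \<cdot>\<^bsub>C\<^esub> \<mu> x"

text \<open>
  The Eilenberg-Moore category. An object is an algebra \<open>(x, h)\<close>; a morphism is a triple
  consisting of its domain, its underlying morphism, and its codomain.
\<close>

definition EM ::
  "('o, 'm) cat \<Rightarrow> ('o, 'm, 'o, 'm) ftor \<Rightarrow> ('o \<Rightarrow> 'm) \<Rightarrow> ('o \<Rightarrow> 'm) \<Rightarrow>
   ('o \<times> 'm, ('o \<times> 'm) \<times> 'm \<times> ('o \<times> 'm)) cat"
where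
  "EM C T \<eta> \<mu> =
     \<lparr>Obj = {(x, h). is_algebra C T \<eta> \<mu> x h},
      Arr = {((x, h), f, (y, k)) | x h f y k.
               is_algebra C T \<eta> \<mu> x h \<and> is_algebra C T \<eta> \<mu> y k \<and>
               f \<in> Hom C x y \<and> f \<cdot>\<^bsub>C\<^esub> h = k \<cdot>\<^bsub>C\<^esub> FM T f},
      Dom = (\<lambda>(A, f, B). A),
      Cod = (\<lambda>(A, f, B). B),
      Idn = (\<lambda>A. (A, Idn C (fst A), A)),
      Cmp = (\<lambda>(B, g, D) (A, f, B'). (A, g \<cdot>\<^bsub>C\<^esub> f, D))\<rparr>"

definition comparison ::
  "('o1, 'm1) cat \<Rightarrow> ('o1, 'm1, 'o2, 'm2) ftor \<Rightarrow> ('o1 \<Rightarrow> 'm1) \<Rightarrow>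
   ('o1, 'm1, 'o2 \<times> 'm2, ('o2 \<times> 'm2) \<times> 'm2 \<times> ('o2 \<times> 'm2)) ftor"
where
  "comparison UU U \<epsilon> =
     (let K = (\<lambda>b. (FO U b, FM U (\<epsilon> b)))
      in \<lparr>FO = K, FM = (\<lambda>f. (K (Dom UU f), FM U f, K (Cod UU f)))\<rparr>)"

definition is_monadic_adjunction ::
  "('o1, 'm1) cat \<Rightarrow> ('o2, 'm2) cat \<Rightarrow> ('o2, 'm2, 'o1, 'm1) ftor \<Rightarrow> ('o1, 'm1, 'o2, 'm2) ftor \<Rightarrow>
   ('o2 \<Rightarrow> 'm2) \<Rightarrow> ('o1 \<Rightarrow> 'm1) \<Rightarrow> bool"
where
  "is_monadic_adjunction UU VV F U \<eta> \<epsilon> \<longleftrightarrow>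
     is_adjunction UU VV F U \<eta> \<epsilon> \<and>
     is_equivalence UU (EM VV (comp_ftor U F) \<eta> (\<lambda>x. FM U (\<epsilon> (FO F x)))) (comparison UU U \<epsilon>)"

definition ideally_exact_context ::
  "('o1, 'm1) cat \<Rightarrow> ('o2, 'm2) cat \<Rightarrow> ('o2, 'm2, 'o1, 'm1) ftor \<Rightarrow> ('o1, 'm1, 'o2, 'm2) ftor \<Rightarrow>
   ('o2 \<Rightarrow> 'm2) \<Rightarrow> ('o1 \<Rightarrow> 'm1) \<Rightarrow> bool"
where
  "ideally_exact_context UU VV F U \<eta> \<epsilon> \<longleftrightarrow>
     is_monadic_adjunction UU VV F U \<eta> \<epsilon> \<and> ideally_exact UU \<and> semi_abelian VV \<and>
     (\<forall>f\<in>Arr VV. is_pullback VV (FM U (FM F f)) (\<eta> (Cod VV f)) (\<eta> (Dom VV f)) f)"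

section \<open>Internal actions\<close>

text \<open>
  A choice, in a semi-abelian category, of a zero object, of binary coproducts and of the kernels
  \<open>\<kappa> c x : c \<flat> x \<rightarrow> c + x\<close> of \<open>[id, 0] : c + x \<rightarrow> c\<close>. The objects \<open>c + x\<close> and \<open>c \<flat> x\<close> are read off
  from the chosen morphisms.
\<close>

record ('o, 'm) choices =
  zob :: 'o
  in1 :: "'o \<Rightarrow> 'o \<Rightarrow> 'm"
  in2 :: "'o \<Rightarrow> 'o \<Rightarrow> 'm"
  ker :: "'o \<Rightarrow> 'o \<Rightarrow> 'm"

definition cop :: "('o, 'm) cat \<Rightarrow> ('o, 'm) choices \<Rightarrow> 'o \<Rightarrow> 'o \<Rightarrow> 'o" where
  "cop V S a b = Cod V (in1 S a b)"

definition flat :: "('o, 'm) cat \<Rightarrow> ('o, 'm) choices \<Rightarrow> 'o \<Rightarrow> 'o \<Rightarrow> 'o" where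
  "flat V S c x = Dom V (ker S c x)"

definition copair :: "('o, 'm) cat \<Rightarrow> ('o, 'm) choices \<Rightarrow> 'm \<Rightarrow> 'm \<Rightarrow> 'm" where
  "copair V S f g =
     (THE h. h \<in> Hom V (cop V S (Dom V f) (Dom V g)) (Cod V f) \<and>
             h \<cdot>\<^bsub>V\<^esub> in1 S (Dom V f) (Dom V g) = f \<and> h \<cdot>\<^bsub>V\<^esub> in2 S (Dom V f) (Dom V g) = g)"

definition valid_choices :: "('o, 'm) cat \<Rightarrow> ('o, 'm) choices \<Rightarrow> bool" where
  "valid_choices V S \<longleftrightarrow>
     is_zero_object V (zob S) \<and>
     (\<forall>a\<in>Obj V. \<forall>b\<in>Obj V. is_coproduct V a b (in1 S a b) (in2 S a b)) \<and>
     (\<forall>c\<in>Obj V. \<forall>x\<in>Obj V. is_kernel V (ker S c x) (copair V S (Idn V c) (zero_mor V x c)))"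

definition cop_map :: "('o, 'm) cat \<Rightarrow> ('o, 'm) choices \<Rightarrow> 'm \<Rightarrow> 'm \<Rightarrow> 'm" where
  "cop_map V S g f =
     copair V S (in1 S (Cod V g) (Cod V f) \<cdot>\<^bsub>V\<^esub> g) (in2 S (Cod V g) (Cod V f) \<cdot>\<^bsub>V\<^esub> f)"

definition flat_map :: "('o, 'm) cat \<Rightarrow> ('o, 'm) choices \<Rightarrow> 'm \<Rightarrow> 'm \<Rightarrow> 'm" where
  "flat_map V S g f =
     (THE h. h \<in> Hom V (flat V S (Dom V g) (Dom V f)) (flat V S (Cod V g) (Cod V f)) \<and>
             ker S (Cod V g) (Cod V f) \<cdot>\<^bsub>V\<^esub> h = cop_map V S g f \<cdot>\<^bsub>V\<^esub> ker S (Dom V g) (Dom V f))"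

definition flat_ftor :: "('o, 'm) cat \<Rightarrow> ('o, 'm) choices \<Rightarrow> 'o \<Rightarrow> ('o, 'm, 'o, 'm) ftor" where
  "flat_ftor V S c = \<lparr>FO = flat V S c, FM = flat_map V S (Idn V c)\<rparr>"

definition flat_unit :: "('o, 'm) cat \<Rightarrow> ('o, 'm) choices \<Rightarrow> 'o \<Rightarrow> 'o \<Rightarrow> 'm" where
  "flat_unit V S c x = (THE u. u \<in> Hom V x (flat V S c x) \<and> ker S c x \<cdot>\<^bsub>V\<^esub> u = in2 S c x)"

definition flat_mult :: "('o, 'm) cat \<Rightarrow> ('o, 'm) choices \<Rightarrow> 'o \<Rightarrow> 'o \<Rightarrow> 'm" where
  "flat_mult V S c x =
     (THE m. m \<in> Hom V (flat V S c (flat V S c x)) (flat V S c x) \<and>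
             ker S c x \<cdot>\<^bsub>V\<^esub> m = copair V S (in1 S c x) (ker S c x) \<cdot>\<^bsub>V\<^esub> ker S c (flat V S c x))"

definition is_internal_action ::
  "('o, 'm) cat \<Rightarrow> ('o, 'm) choices \<Rightarrow> 'o \<Rightarrow> 'o \<Rightarrow> 'm \<Rightarrow> bool"
where
  "is_internal_action V S c x \<xi> \<longleftrightarrow>
     is_algebra V (flat_ftor V S c) (flat_unit V S c) (flat_mult V S c) x \<xi>"

definition is_associated ::
  "('o, 'm) cat \<Rightarrow> ('o, 'm) choices \<Rightarrow> 'o \<Rightarrow> 'o \<Rightarrow> 'm \<Rightarrow> 'o \<Rightarrow> 'm \<Rightarrow> 'm \<Rightarrow> bool"
where
  "is_associated V S c x \<xi> a p s \<longleftrightarrow>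
     is_point V a c p s \<and>
     (\<exists>k\<in>Hom V x a. is_kernel V k p \<and> k \<cdot>\<^bsub>V\<^esub> \<xi> = copair V S s k \<cdot>\<^bsub>V\<^esub> ker S c x)"

section \<open>Relative actions\<close>

definition is_relative_action ::
  "('o2, 'm2) cat \<Rightarrow> ('o2, 'm2) choices \<Rightarrow> ('o1, 'm1, 'o2, 'm2) ftor \<Rightarrow> 'o1 \<Rightarrow> 'o2 \<Rightarrow> 'm2 \<Rightarrow> bool"
where
  "is_relative_action VV S U B X \<xi> \<longleftrightarrow> is_internal_action VV S (FO U B) X \<xi>"

text \<open>The action \<open>\<xi>\<^sub>0\<close>; it is determined by the defining equation because \<open>\<eta> X\<close> is monic.\<close>

definition xi0 ::
  "('o2, 'm2) cat \<Rightarrow> ('o2, 'm2) choices \<Rightarrow> ('o2, 'm2, 'o1, 'm1) ftor \<Rightarrow> ('o1, 'm1, 'o2, 'm2) ftor \<Rightarrow>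
   ('o2 \<Rightarrow> 'm2) \<Rightarrow> 'o2 \<Rightarrow> 'm2"
where
  "xi0 VV S F U \<eta> X =
     (THE \<xi>. \<xi> \<in> Hom VV (flat VV S (FO U (FO F (zob S))) X) X \<and>
             \<eta> X \<cdot>\<^bsub>VV\<^esub> \<xi> =
               copair VV S (FM U (FM F (the_mor VV (zob S) X))) (\<eta> X) \<cdot>\<^bsub>VV\<^esub>
               ker S (FO U (FO F (zob S))) X)"

definition is_coherent ::
  "('o1, 'm1) cat \<Rightarrow> ('o2, 'm2) cat \<Rightarrow> ('o2, 'm2) choices \<Rightarrow> ('o2, 'm2, 'o1, 'm1) ftor \<Rightarrow>
   ('o1, 'm1, 'o2, 'm2) ftor \<Rightarrow> ('o2 \<Rightarrow> 'm2) \<Rightarrow> 'o1 \<Rightarrow> 'o2 \<Rightarrow> 'm2 \<Rightarrow> bool"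
where
  "is_coherent UU VV S F U \<eta> B X \<xi> \<longleftrightarrow>
     \<xi> \<cdot>\<^bsub>VV\<^esub> flat_map VV S (FM U (the_mor UU (FO F (zob S)) B)) (Idn VV X) = xi0 VV S F U \<eta> X"

definition is_ideal_split_epi ::
  "('o1, 'm1) cat \<Rightarrow> ('o2, 'm2) cat \<Rightarrow> ('o1, 'm1, 'o2, 'm2) ftor \<Rightarrow> 'o1 \<Rightarrow> 'o2 \<Rightarrow> 'm2 \<Rightarrow> 'm2 \<Rightarrow> bool"
where
  "is_ideal_split_epi UU VV U B a p s \<longleftrightarrow>
     (\<exists>a' p' s' \<sigma>. is_point UU a' B p' s' \<and>
        \<sigma> \<in> Hom VV (FO U a') a \<and> is_iso VV \<sigma> \<and>
        p \<cdot>\<^bsub>VV\<^esub> \<sigma> = FM U p' \<and> \<sigma> \<cdot>\<^bsub>VV\<^esub> FM U s' = s)"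

definition is_ideal_action ::
  "('o1, 'm1) cat \<Rightarrow> ('o2, 'm2) cat \<Rightarrow> ('o2, 'm2) choices \<Rightarrow> ('o1, 'm1, 'o2, 'm2) ftor \<Rightarrow>
   'o1 \<Rightarrow> 'o2 \<Rightarrow> 'm2 \<Rightarrow> bool"
where
  "is_ideal_action UU VV S U B X \<xi> \<longleftrightarrow>
     (\<forall>a p s. is_associated VV S (FO U B) X \<xi> a p s \<longrightarrow> is_ideal_split_epi UU VV U B a p s)"

end

theory Submission
  imports Defs
begin

text \<open>
  Suppose that \<open>\<xi>\<close> is associated with a point over \<open>U B\<close> with section \<open>s\<close> and kernel \<open>k\<close>
  with domain \<open>X\<close>, so that \<open>k \<cdot> \<xi> = [s, k] \<cdot> \<kappa>\<close>, and that this point is, up to an isomorphism along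
  which \<open>k\<close> can be transported, the image under \<open>U\<close> of a point with domain \<open>A'\<close> and section \<open>s'\<close>.
  The morphism \<open>k\<close> is \<open>U f \<cdot> \<eta> X\<close> for its transpose \<open>f : F X \<rightarrow> A'\<close>.
  As \<open>F 0\<close> is initial, \<open>f \<cdot> F(0 \<rightarrow> X)\<close> is \<open>s' \<cdot> \<iota>\<^sub>B\<close>, so \<open>U f\<close> carries the equation defining
  \<open>\<xi>\<^sub>0\<close> to \<open>k \<cdot> \<xi>\<^sub>0 = [s \<cdot> U \<iota>\<^sub>B, k] \<cdot> \<kappa>\<close>. But \<open>\<xi> \<cdot> (U \<iota>\<^sub>B \<flat> id)\<close> satisfies the same
  equation, and \<open>k\<close> is monic. This is \<open>coherent_if_associated_point_lifts\<close>.

  Being ideal is a condition on all points associated with \<open>\<xi>\<close>, hence says nothing unless there is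
  one. Most of the work is therefore the existence of semidirect products in a semi-abelian category,
  \<open>internal_action_has_associated_point\<close>. The point is a quotient of \<open>C + X\<close> by the relation
  generated by a reflexive pair. Images (\<open>image_relation\<close>), the fact that reflexive relations in a
  protomodular category are equivalence relations (\<open>reflexive_relation_is_equivalence\<close>), and
  exactness (\<open>effective_quotient\<close>) together describe which elements the quotient identifies, and
  the kernel of the quotient over \<open>C\<close> can then be computed with generalised elements.

  Throughout, a generalised element of an object is a morphism into it, and covering its domain by a
  regular epimorphism plays the role of choosing preimages.
\<close>

section \<open>Composition, monomorphisms and epimorphisms\<close>

locale category =
  fixes C :: "('o, 'm) cat" (structure)
  assumes is_category: "is_category C"
begin

lemma in_Hom: "f \<in> Hom C a b \<longleftrightarrow> f \<in> Arr C \<and> Dom C f = a \<and> Cod C f = b"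
  by (auto simp: Hom_def)

lemma arr_obj [simp]: "f \<in> Arr C \<Longrightarrow> Dom C f \<in> Obj C" "f \<in> Arr C \<Longrightarrow> Cod C f \<in> Obj C"
  using is_category by (auto simp: is_category_def)

lemma Hom_obj: "f \<in> Hom C a b \<Longrightarrow> a \<in> Obj C \<and> b \<in> Obj C"
  by (auto simp: in_Hom)

lemma idn [simp]:
  assumes "a \<in> Obj C"
  shows "Idn C a \<in> Arr C" "Dom C (Idn C a) = a" "Cod C (Idn C a) = a"
  using is_category assms by (auto simp: is_category_def in_Hom)

lemma cmp [simp]:
  assumes "f \<in> Arr C" "g \<in> Arr C" "Cod C f = Dom C g"
  shows "g \<cdot> f \<in> Arr C" "Dom C (g \<cdot> f) = Dom C f" "Cod C (g \<cdot> f) = Cod C g"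
  using is_category assms by (auto simp: is_category_def in_Hom)

lemma cmp_idn [simp]:
  "f \<in> Arr C \<Longrightarrow> Dom C f = a \<Longrightarrow> f \<cdot> Idn C a = f"
  "f \<in> Arr C \<Longrightarrow> Cod C f = a \<Longrightarrow> Idn C a \<cdot> f = f"
  using is_category by (auto simp: is_category_def)

lemma assoc [simp]:
  assumes "f \<in> Arr C" "g \<in> Arr C" "h \<in> Arr C" "Cod C f = Dom C g" "Cod C g = Dom C h"
  shows "(h \<cdot> g) \<cdot> f = h \<cdot> (g \<cdot> f)"
  using is_category assms by (simp add: is_category_def)

text \<open>
  Composites are normalised by associating to the right; this turns an equation between composites
  into a rewrite rule that also fires when a further morphism follows on the right.
\<close>

lemma reassoc:
  assumes "g \<cdot> f = k"
    and "f \<in> Arr C" "g \<in> Arr C" "Cod C f = Dom C g" "x \<in> Arr C" "Cod C x = Dom C f"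
  shows "g \<cdot> (f \<cdot> x) = k \<cdot> x"
  using assms assoc by metis

definition mono :: "'m \<Rightarrow> bool" where
  "mono m \<longleftrightarrow> m \<in> Arr C \<and>
     (\<forall>t u v. u \<in> Hom C t (Dom C m) \<longrightarrow> v \<in> Hom C t (Dom C m) \<longrightarrow> m \<cdot> u = m \<cdot> v \<longrightarrow> u = v)"

definition jointly_monic :: "'m \<Rightarrow> 'm \<Rightarrow> bool" where
  "jointly_monic r1 r2 \<longleftrightarrow> r1 \<in> Arr C \<and> r2 \<in> Hom C (Dom C r1) (Cod C r1) \<and>
     (\<forall>t u v. u \<in> Hom C t (Dom C r1) \<longrightarrow> v \<in> Hom C t (Dom C r1) \<longrightarrow>
        r1 \<cdot> u = r1 \<cdot> v \<longrightarrow> r2 \<cdot> u = r2 \<cdot> v \<longrightarrow> u = v)"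

lemma monoD:
  assumes "mono m" "m \<cdot> u = m \<cdot> v" "u \<in> Hom C t (Dom C m)" "v \<in> Hom C t (Dom C m)"
  shows "u = v"
  using assms by (auto simp: mono_def)

lemma mono_cmp:
  assumes m: "mono m" and n: "mono n" and d: "Cod C n = Dom C m"
  shows "mono (m \<cdot> n)"
  unfolding mono_def
proof (intro conjI allI impI)
  have a [simp]: "m \<in> Arr C" "n \<in> Arr C" using m n by (simp_all add: mono_def)
  note [simp] = d
  show "m \<cdot> n \<in> Arr C" by simp
  fix t u v assume u: "u \<in> Hom C t (Dom C (m \<cdot> n))" and v: "v \<in> Hom C t (Dom C (m \<cdot> n))"
    and e: "(m \<cdot> n) \<cdot> u = (m \<cdot> n) \<cdot> v"
  have uv: "u \<in> Hom C t (Dom C n)" "v \<in> Hom C t (Dom C n)" using u v by simp_all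
  note [simp] = uv[unfolded in_Hom]
  have "n \<cdot> u = n \<cdot> v"
  proof (rule monoD[OF m, of _ _ t])
    show "m \<cdot> n \<cdot> u = m \<cdot> n \<cdot> v" using e by simp
  qed (simp_all add: in_Hom)
  then show "u = v" by (rule monoD[OF n _ uv])
qed

lemma split_mono:
  assumes m: "m \<in> Hom C a b" and r: "r \<in> Hom C b a" and rm: "r \<cdot> m = Idn C a"
  shows "mono m"
  unfolding mono_def
proof (intro conjI allI impI)
  note [simp] = m[unfolded in_Hom] r[unfolded in_Hom]
  show "m \<in> Arr C" by simp
  fix t u v assume uv: "u \<in> Hom C t (Dom C m)" "v \<in> Hom C t (Dom C m)" and e: "m \<cdot> u = m \<cdot> v"
  note [simp] = uv[unfolded in_Hom]
  have "u = r \<cdot> (m \<cdot> u)" using reassoc[OF rm, of u] by simp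
  also have "\<dots> = r \<cdot> (m \<cdot> v)" by (simp only: e)
  also have "\<dots> = v" using reassoc[OF rm, of v] by simp
  finally show "u = v" .
qed

lemma jointly_monicD:
  assumes "jointly_monic r1 r2" "r1 \<cdot> u = r1 \<cdot> v" "r2 \<cdot> u = r2 \<cdot> v"
    "u \<in> Hom C t (Dom C r1)" "v \<in> Hom C t (Dom C r1)"
  shows "u = v"
  using assms by (auto simp: jointly_monic_def)

lemma jointly_monic_arr:
  assumes "jointly_monic r1 r2"
  shows "r1 \<in> Arr C" "r2 \<in> Arr C" "Dom C r2 = Dom C r1" "Cod C r2 = Cod C r1"
  using assms by (auto simp: jointly_monic_def in_Hom)

lemma coequalizer_arr:
  assumes "is_coequalizer C f g e"
  shows "e \<in> Arr C" "f \<in> Arr C" "g \<in> Arr C" "Dom C g = Dom C f" "Cod C g = Cod C f"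
    "Dom C e = Cod C f" "e \<cdot> f = e \<cdot> g"
  using assms by (auto simp: is_coequalizer_def in_Hom)

lemma coequalizer_descend:
  assumes "is_coequalizer C f g e" "u \<in> Hom C (Dom C e) x" "u \<cdot> f = u \<cdot> g"
  obtains h where "h \<in> Hom C (Cod C e) x" "h \<cdot> e = u"
proof -
  note coequalizer_arr[OF assms(1), simp]
  have "x \<in> Obj C" using assms(2) Hom_obj by blast
  moreover have "u \<in> Hom C (Cod C f) x" using assms(2) by simp
  ultimately have "\<exists>!h. h \<in> Hom C (Cod C e) x \<and> h \<cdot> e = u"
    using assms(1,3) unfolding is_coequalizer_def by blast
  then show thesis using that by blast
qed

lemma regular_epi_arr: "is_regular_epi C e \<Longrightarrow> e \<in> Arr C"
  unfolding is_regular_epi_def using coequalizer_arr by blast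

lemma regular_epi_cancel:
  assumes "is_regular_epi C e" "u \<cdot> e = v \<cdot> e" "u \<in> Hom C (Cod C e) x" "v \<in> Hom C (Cod C e) x"
  shows "u = v"
proof -
  obtain f g where c: "is_coequalizer C f g e" using assms(1) by (auto simp: is_regular_epi_def)
  note coequalizer_arr[OF c, simp]
  have "x \<in> Obj C" using assms(3) Hom_obj by blast
  moreover have "v \<cdot> e \<in> Hom C (Cod C f) x" using assms(4) by (auto simp: in_Hom)
  moreover have "(v \<cdot> e) \<cdot> f = (v \<cdot> e) \<cdot> g" using assms(4) coequalizer_arr(7)[OF c] by (simp add: in_Hom)
  ultimately have "\<exists>!h. h \<in> Hom C (Cod C e) x \<and> h \<cdot> e = v \<cdot> e"
    using c unfolding is_coequalizer_def by blast
  then show ?thesis using assms by blast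
qed

text \<open>
  Descent along a regular epimorphism can be tested on generalised elements, so that the parallel
  pair of which it is a coequalizer never has to be named.
\<close>

lemma regular_epi_descend:
  assumes "is_regular_epi C e" "u \<in> Hom C (Dom C e) x"
    and "\<And>t a b. a \<in> Hom C t (Dom C e) \<Longrightarrow> b \<in> Hom C t (Dom C e) \<Longrightarrow> e \<cdot> a = e \<cdot> b \<Longrightarrow> u \<cdot> a = u \<cdot> b"
  obtains h where "h \<in> Hom C (Cod C e) x" "h \<cdot> e = u"
proof -
  obtain f g where c: "is_coequalizer C f g e" using assms(1) by (auto simp: is_regular_epi_def)
  note coequalizer_arr[OF c, simp]
  have "u \<cdot> f = u \<cdot> g" by (rule assms(3)[of _ "Dom C f"]) (simp_all add: in_Hom)
  then show thesis using coequalizer_descend[OF c assms(2)] that by blast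
qed

section \<open>Pullbacks, products and zero morphisms\<close>

lemma pullback_arr:
  assumes "is_pullback C f g p q"
  shows "f \<in> Arr C" "g \<in> Arr C" "Cod C g = Cod C f" "p \<in> Arr C" "q \<in> Arr C" "Dom C q = Dom C p"
    "Cod C p = Dom C f" "Cod C q = Dom C g" "f \<cdot> p = g \<cdot> q"
  using assms unfolding is_pullback_def in_Hom by simp_all

lemma pullback_lift:
  assumes "is_pullback C f g p q" "u \<in> Hom C x (Dom C f)" "v \<in> Hom C x (Dom C g)" "f \<cdot> u = g \<cdot> v"
  obtains h where "h \<in> Hom C x (Dom C p)" "p \<cdot> h = u" "q \<cdot> h = v"
proof -
  have "x \<in> Obj C" using assms(2) Hom_obj by blast
  then have "\<exists>!h. h \<in> Hom C x (Dom C p) \<and> p \<cdot> h = u \<and> q \<cdot> h = v"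
    using assms unfolding is_pullback_def by blast
  then show thesis using that by blast
qed

lemma pullback_unique:
  assumes "is_pullback C f g p q" "h \<in> Hom C x (Dom C p)" "h' \<in> Hom C x (Dom C p)"
    "p \<cdot> h = p \<cdot> h'" "q \<cdot> h = q \<cdot> h'"
  shows "h = h'"
proof -
  note pullback_arr[OF assms(1), simp]
  have "x \<in> Obj C" using assms(2) Hom_obj by blast
  moreover have "p \<cdot> h' \<in> Hom C x (Dom C f)" "q \<cdot> h' \<in> Hom C x (Dom C g)"
    using assms(3) by (auto simp: in_Hom)
  moreover have "f \<cdot> (p \<cdot> h') = g \<cdot> (q \<cdot> h')"
    using assms(3) reassoc[OF pullback_arr(9)[OF assms(1)]] by (simp add: in_Hom)
  ultimately have "\<exists>!k. k \<in> Hom C x (Dom C p) \<and> p \<cdot> k = p \<cdot> h' \<and> q \<cdot> k = q \<cdot> h'"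
    using assms(1) unfolding is_pullback_def by blast
  then show ?thesis using assms by blast
qed

lemma pullback_mono:
  assumes "is_pullback C f g p q" "mono g"
  shows "mono p"
  unfolding mono_def
proof (intro conjI allI impI)
  note pullback_arr[OF assms(1), simp]
  note R = reassoc[OF pullback_arr(9)[OF assms(1)]]
  show "p \<in> Arr C" by simp
  fix t u v assume u: "u \<in> Hom C t (Dom C p)" and v: "v \<in> Hom C t (Dom C p)" and e: "p \<cdot> u = p \<cdot> v"
  have "g \<cdot> (q \<cdot> u) = f \<cdot> (p \<cdot> u)" using u R by (simp add: in_Hom)
  also have "\<dots> = g \<cdot> (q \<cdot> v)" unfolding e using v R by (simp add: in_Hom)
  finally have "q \<cdot> u = q \<cdot> v"
    by (rule monoD[OF assms(2), of _ _ t]) (use u v in \<open>auto simp: in_Hom\<close>)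
  then show "u = v" using pullback_unique[OF assms(1) u v e] by simp
qed

text \<open>Here \<open>f\<close> factors through \<open>q\<close>, so whatever \<open>q\<close> identifies is identified by \<open>f\<close>.\<close>

lemma coequalizer_of_kernel_pair_has_same_kernel_pair:
  assumes k: "is_kernel_pair C f r1 r2" and c: "is_coequalizer C r1 r2 q"
  shows "is_kernel_pair C q r1 r2"
proof -
  note k' = k[unfolded is_kernel_pair_def]
  note pullback_arr(1,2,4-9)[OF k', simp] coequalizer_arr[OF c, simp]
  obtain h where h [unfolded in_Hom, simp]: "h \<in> Hom C (Cod C q) (Cod C f)" and hq: "h \<cdot> q = f"
    by (rule coequalizer_descend[OF c, of f "Cod C f"]) (assumption | simp (no_asm) add: in_Hom)+
  show ?thesis
    unfolding is_kernel_pair_def is_pullback_def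
  proof (intro conjI ballI impI)
    fix x u v assume u: "u \<in> Hom C x (Dom C q)" and v: "v \<in> Hom C x (Dom C q)" and e: "q \<cdot> u = q \<cdot> v"
    have "(h \<cdot> q) \<cdot> u = (h \<cdot> q) \<cdot> v" using u v e by (simp add: in_Hom del: hq)
    then have fe: "f \<cdot> u = f \<cdot> v" using hq by simp
    obtain w where w: "w \<in> Hom C x (Dom C r1)" "r1 \<cdot> w = u" "r2 \<cdot> w = v"
      using pullback_lift[OF k' _ _ fe] u v by auto
    show "\<exists>!w. w \<in> Hom C x (Dom C r1) \<and> r1 \<cdot> w = u \<and> r2 \<cdot> w = v"
    proof (rule ex1I)
      fix w' assume w': "w' \<in> Hom C x (Dom C r1) \<and> r1 \<cdot> w' = u \<and> r2 \<cdot> w' = v"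
      show "w' = w" by (rule pullback_unique[OF k', of _ x]) (simp_all only: w w')
    qed (simp add: w)
  qed (simp_all add: in_Hom)
qed

lemma point_iff: "is_point C a b p s \<longleftrightarrow> p \<in> Arr C \<and> s \<in> Arr C \<and> Dom C p = a \<and> Cod C p = b \<and>
    Dom C s = b \<and> Cod C s = a \<and> p \<cdot> s = Idn C b"
  by (auto simp: is_point_def in_Hom)

lemma the_mor_initial:
  assumes "is_initial C z" "a \<in> Obj C"
  shows "the_mor C z a \<in> Hom C z a" "f \<in> Hom C z a \<Longrightarrow> f = the_mor C z a"
proof -
  have "\<exists>!f. f \<in> Hom C z a" using assms by (auto simp: is_initial_def)
  then show 1: "the_mor C z a \<in> Hom C z a" unfolding the_mor_def by (rule theI')
  show "f = the_mor C z a" if "f \<in> Hom C z a" using 1 that \<open>\<exists>!f. f \<in> Hom C z a\<close> by blast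
qed

end

locale finitely_complete_category = category +
  assumes finite_limits: "has_finite_limits C"
begin

lemma pullback_ex:
  assumes "f \<in> Arr C" "g \<in> Arr C" "Cod C f = Cod C g"
  obtains p q where "is_pullback C f g p q"
  using assms finite_limits unfolding has_finite_limits_def by blast

lemma square_ex:
  assumes a: "a \<in> Obj C"
  obtains p q where "jointly_monic p q" "Cod C p = a"
    and "\<And>x u v. u \<in> Hom C x a \<Longrightarrow> v \<in> Hom C x a \<Longrightarrow> \<exists>h \<in> Hom C x (Dom C p). p \<cdot> h = u \<and> q \<cdot> h = v"
proof -
  obtain t where t: "is_terminal C t" using finite_limits by (auto simp: has_finite_limits_def)
  have ex: "\<exists>f. f \<in> Hom C x t" and un: "f \<in> Hom C x t \<Longrightarrow> g \<in> Hom C x t \<Longrightarrow> f = g"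
    if "x \<in> Obj C" for x f g
    using t that unfolding is_terminal_def by blast+
  obtain f where f: "f \<in> Hom C a t" using ex a by blast
  note [simp] = f[unfolded in_Hom]
  obtain p q where pb: "is_pullback C f f p q" using pullback_ex[of f f] by auto
  note [simp] = pullback_arr(1,2,4-8)[OF pb]
  show thesis
  proof (rule that[of p q])
    show "jointly_monic p q"
      unfolding jointly_monic_def using pullback_unique[OF pb] by (simp add: in_Hom)
    fix x u v assume u: "u \<in> Hom C x a" and v: "v \<in> Hom C x a"
    have "f \<cdot> u \<in> Hom C x t" "f \<cdot> v \<in> Hom C x t" using u v by (simp_all add: in_Hom)
    then have fuv: "f \<cdot> u = f \<cdot> v" using un Hom_obj[OF u] by blast
    obtain h where "h \<in> Hom C x (Dom C p)" "p \<cdot> h = u" "q \<cdot> h = v"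
      by (rule pullback_lift[OF pb _ _ fuv]) (use u v in simp_all)
    then show "\<exists>h \<in> Hom C x (Dom C p). p \<cdot> h = u \<and> q \<cdot> h = v" by blast
  qed simp
qed

end

section \<open>Images in regular categories\<close>

locale regular_cat = finitely_complete_category +
  assumes regular: "regular_category C"
begin

lemma pullback_regular_epi:
  assumes "is_pullback C e g p q" "is_regular_epi C e"
  shows "is_regular_epi C q"
  using assms regular unfolding regular_category_def by blast

text \<open>
  Generalised elements lift along a regular epimorphism after passing to a regular epimorphic cover
  of their domain. This is the form in which pullback stability is used below.
\<close>

lemma regular_epi_cover:
  assumes "is_regular_epi C e" "u \<in> Hom C x (Cod C e)"
  obtains c w where "is_regular_epi C c" "Cod C c = x" "w \<in> Hom C (Dom C c) (Dom C e)"
    "e \<cdot> w = u \<cdot> c"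
proof -
  note regular_epi_arr[OF assms(1), simp] assms(2)[unfolded in_Hom, simp]
  obtain w c where pb: "is_pullback C e u w c" using pullback_ex[of e u] by auto
  note pullback_arr[OF pb, simp]
  show thesis
    by (rule that[of c w]) (use pullback_regular_epi[OF pb assms(1)] in \<open>simp_all add: in_Hom\<close>)
qed

text \<open>
  The image of \<open>f\<close> is the coequalizer \<open>e\<close> of its kernel pair. Two elements of it with the same image
  lift, on a common cover, to two elements that \<open>f\<close> identifies; these form an element of the kernel
  pair, so \<open>e\<close> identifies them.
\<close>

lemma image_factorization:
  assumes f [simp]: "f \<in> Arr C"
  obtains e m where "is_regular_epi C e" "Dom C e = Dom C f" "mono m" "m \<in> Hom C (Cod C e) (Cod C f)"
    "m \<cdot> e = f"
proof -
  obtain k1 k2 where kp: "is_pullback C f f k1 k2" using pullback_ex[of f f] by auto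
  note pullback_arr(1,2,4-9)[OF kp, simp]
  obtain e where ce: "is_coequalizer C k1 k2 e"
    using regular kp unfolding regular_category_def is_kernel_pair_def by blast
  note coequalizer_arr[OF ce, simp]
  have e: "is_regular_epi C e" using ce by (auto simp: is_regular_epi_def)
  obtain m where m [unfolded in_Hom, simp]: "m \<in> Hom C (Cod C e) (Cod C f)" and me: "m \<cdot> e = f"
    by (rule coequalizer_descend[OF ce, of f "Cod C f"]) (assumption | simp (no_asm) add: in_Hom)+
  note R = reassoc[OF me]
  have "mono m"
    unfolding mono_def
  proof (intro conjI allI impI)
    fix t u v assume u: "u \<in> Hom C t (Dom C m)" and v: "v \<in> Hom C t (Dom C m)" and uv: "m \<cdot> u = m \<cdot> v"
    note [simp] = u[unfolded in_Hom] v[unfolded in_Hom]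
    obtain c a where c: "is_regular_epi C c"
      and ca [unfolded in_Hom, simp]: "Cod C c = t" "a \<in> Hom C (Dom C c) (Dom C e)"
      and ea: "e \<cdot> a = u \<cdot> c"
      by (rule regular_epi_cover[OF e, of u t]) (use u in \<open>simp_all add: in_Hom\<close>)
    note regular_epi_arr[OF c, simp]
    obtain d b where d: "is_regular_epi C d"
      and db [unfolded in_Hom, simp]: "Cod C d = Dom C c" "b \<in> Hom C (Dom C d) (Dom C e)"
      and eb: "e \<cdot> b = (v \<cdot> c) \<cdot> d"
      by (rule regular_epi_cover[OF e, of "v \<cdot> c" "Dom C c"]) (use v in \<open>simp_all add: in_Hom\<close>)
    note regular_epi_arr[OF d, simp]
    have "f \<cdot> (a \<cdot> d) = m \<cdot> (u \<cdot> (c \<cdot> d))"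
      using R[of "a \<cdot> d"] reassoc[OF ea, of d] by simp
    also have "\<dots> = m \<cdot> (v \<cdot> (c \<cdot> d))" using reassoc[OF uv, of "c \<cdot> d"] by simp
    also have "\<dots> = f \<cdot> b" using R[of b] eb by simp
    finally have "f \<cdot> (a \<cdot> d) = f \<cdot> b" .
    then obtain w where w [unfolded in_Hom, simp]: "w \<in> Hom C (Dom C d) (Dom C k1)"
      and kw: "k1 \<cdot> w = a \<cdot> d" "k2 \<cdot> w = b"
      by (rule pullback_lift[OF kp, of "a \<cdot> d" "Dom C d" b, rotated 2]) (simp_all add: in_Hom)
    have "e \<cdot> (a \<cdot> d) = e \<cdot> b"
      using reassoc[OF coequalizer_arr(7)[OF ce], of w] kw by simp
    then have "(u \<cdot> c) \<cdot> d = (v \<cdot> c) \<cdot> d" using reassoc[OF ea, of d] eb by simp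
    then have "u \<cdot> c = v \<cdot> c"
      by (rule regular_epi_cancel[OF d, of _ _ "Dom C m"]) (simp_all add: in_Hom)
    then show "u = v"
      by (rule regular_epi_cancel[OF c, of _ _ "Dom C m"]) (simp_all add: in_Hom)
  qed simp
  then show thesis using that[of e m] e me m by (simp add: in_Hom)
qed

text \<open>Applied to the pairing of \<open>g1\<close> and \<open>g2\<close>, the factorization gives the relation they generate.\<close>

lemma image_relation:
  assumes g1 [simp]: "g1 \<in> Arr C" and g2 [unfolded in_Hom, simp]: "g2 \<in> Hom C (Dom C g1) (Cod C g1)"
  obtains e r1 r2 where "is_regular_epi C e" "Dom C e = Dom C g1" "jointly_monic r1 r2"
    "r1 \<in> Hom C (Cod C e) (Cod C g1)" "r2 \<in> Hom C (Cod C e) (Cod C g1)" "r1 \<cdot> e = g1" "r2 \<cdot> e = g2"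
proof -
  have g12: "g1 \<in> Hom C (Dom C g1) (Cod C g1)" "g2 \<in> Hom C (Dom C g1) (Cod C g1)"
    by (simp_all add: in_Hom)
  obtain p q where jm: "jointly_monic p q" and cp [simp]: "Cod C p = Cod C g1"
    and lift: "\<And>x u v. u \<in> Hom C x (Cod C g1) \<Longrightarrow> v \<in> Hom C x (Cod C g1) \<Longrightarrow>
                 \<exists>h \<in> Hom C x (Dom C p). p \<cdot> h = u \<and> q \<cdot> h = v"
    by (rule square_ex[OF arr_obj(2)[OF g1]]) blast
  note jointly_monic_arr[OF jm, simp]
  obtain f where f [unfolded in_Hom, simp]: "f \<in> Hom C (Dom C g1) (Dom C p)" and pf: "p \<cdot> f = g1" "q \<cdot> f = g2"
    using lift[OF g12] by blast
  obtain e m where e: "is_regular_epi C e" and de [simp]: "Dom C e = Dom C f" and m: "mono m"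
    and mh [unfolded in_Hom, simp]: "m \<in> Hom C (Cod C e) (Cod C f)" and me: "m \<cdot> e = f"
    by (rule image_factorization[of f]) (rule conjunct1[OF f])
  note regular_epi_arr[OF e, simp]
  have "jointly_monic (p \<cdot> m) (q \<cdot> m)"
    unfolding jointly_monic_def
  proof (intro conjI allI impI)
    fix t u v assume u: "u \<in> Hom C t (Dom C (p \<cdot> m))" and v: "v \<in> Hom C t (Dom C (p \<cdot> m))"
      and e: "(p \<cdot> m) \<cdot> u = (p \<cdot> m) \<cdot> v" "(q \<cdot> m) \<cdot> u = (q \<cdot> m) \<cdot> v"
    have "m \<cdot> u = m \<cdot> v"
      by (rule jointly_monicD[OF jm, of _ _ t]) (use u v e in \<open>auto simp: in_Hom\<close>)
    then show "u = v" by (rule monoD[OF m, of _ _ t]) (use u v in \<open>auto simp: in_Hom\<close>)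
  qed (simp_all add: in_Hom)
  then show thesis
    by (rule that[of e "p \<cdot> m" "q \<cdot> m", rotated 2]) (use e me pf in \<open>simp_all add: in_Hom\<close>)
qed

end

section \<open>Reflexive relations in protomodular categories\<close>

locale protomodular_cat = finitely_complete_category +
  assumes protomodular: "protomodular C"
begin

text \<open>
  The section of a split epimorphism \<open>p\<close> and a pullback \<open>x\<close> of it together cover its domain. If both
  factor through a subobject \<open>m\<close>, then the pullback of \<open>m\<close> is a monomorphism split by the
  factorization of \<open>x\<close>, hence an isomorphism, and change of base reflects this.
\<close>

lemma section_and_pullback_cover:
  assumes pt: "is_point C a c p s" and v: "v \<in> Hom C b c" and pb: "is_pullback C p v x q"
    and m: "mono m" "Cod C m = a"
    and x': "x' \<in> Hom C (Dom C x) (Dom C m)" "m \<cdot> x' = x"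
    and s': "s' \<in> Hom C c (Dom C m)" "m \<cdot> s' = s"
  shows "is_iso C m"
proof -
  note [simp] = pt[unfolded point_iff] v[unfolded in_Hom] pullback_arr[OF pb] m(2)
    x'[unfolded in_Hom] s'[unfolded in_Hom]
  have ma [simp]: "m \<in> Arr C" using m by (simp add: mono_def)
  have pm: "is_point C (Dom C m) c (p \<cdot> m) s'" by (simp add: point_iff)
  obtain y r where pb': "is_pullback C (p \<cdot> m) v y r" using pullback_ex[of "p \<cdot> m" v] by auto
  note pullback_arr(1-8)[OF pb', simp]
  have sq: "p \<cdot> (m \<cdot> y) = v \<cdot> r" using pullback_arr(9)[OF pb'] by simp
  obtain h where h [unfolded in_Hom, simp]: "h \<in> Hom C (Dom C y) (Dom C x)" and xh: "x \<cdot> h = m \<cdot> y" "q \<cdot> h = r"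
    by (rule pullback_lift[OF pb, of "m \<cdot> y" "Dom C y" r]) (assumption | simp (no_asm) add: in_Hom sq)+
  obtain g where g [unfolded in_Hom, simp]: "g \<in> Hom C (Dom C x) (Dom C y)" and yg: "y \<cdot> g = x'" "r \<cdot> g = q"
    by (rule pullback_lift[OF pb', of x' "Dom C x" q]) (assumption | simp (no_asm) add: in_Hom)+
  have "h \<cdot> g = Idn C (Dom C x)"
    by (rule pullback_unique[OF pb, of _ "Dom C x"])
      (use reassoc[OF xh(1), of g] reassoc[OF xh(2), of g] yg in \<open>simp_all add: in_Hom\<close>)
  moreover have "g \<cdot> h = Idn C (Dom C y)"
  proof (rule pullback_unique[OF pb', of _ "Dom C y"])
    have "x' \<cdot> h = y"
      by (rule monoD[OF m(1), of _ _ "Dom C y"])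
        (use reassoc[OF x'(2), of h] xh in \<open>simp_all add: in_Hom\<close>)
    then show "y \<cdot> g \<cdot> h = y \<cdot> Idn C (Dom C y)" using reassoc[OF yg(1), of h] by simp
    show "r \<cdot> g \<cdot> h = r \<cdot> Idn C (Dom C y)" using reassoc[OF yg(2), of h] xh by simp
  qed (simp_all add: in_Hom)
  ultimately have ih: "is_iso C h" unfolding is_iso_def by (auto simp: in_Hom)
  show ?thesis
    by (rule protomodular[unfolded protomodular_def, THEN conjunct2, THEN conjunct2, rule_format,
          OF pm pt _ refl s'(2) v pb' pb _ xh ih]) (simp_all add: in_Hom)
qed

text \<open>
  The elements of \<open>a\<close> at which \<open>w1\<close> and \<open>w2\<close> are related form a subobject, so by the previous lemma
  relatedness everywhere follows from relatedness on the section and on the pullback.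
\<close>

lemma relation_tested_on_section_and_pullback:
  assumes pt: "is_point C a c p s" and v: "v \<in> Hom C b c" and pb: "is_pullback C p v x q"
    and r: "jointly_monic r1 r2"
    and w: "w1 \<in> Hom C a (Cod C r1)" "w2 \<in> Hom C a (Cod C r1)"
    and x': "x' \<in> Hom C (Dom C x) (Dom C r1)" "r1 \<cdot> x' = w1 \<cdot> x" "r2 \<cdot> x' = w2 \<cdot> x"
    and s': "s' \<in> Hom C c (Dom C r1)" "r1 \<cdot> s' = w1 \<cdot> s" "r2 \<cdot> s' = w2 \<cdot> s"
  obtains l where "l \<in> Hom C a (Dom C r1)" "r1 \<cdot> l = w1" "r2 \<cdot> l = w2"
proof -
  note [simp] = pt[unfolded point_iff] v[unfolded in_Hom] pullback_arr[OF pb] w[unfolded in_Hom]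
    x'[unfolded in_Hom] s'[unfolded in_Hom]
  note jointly_monic_arr[OF r, simp]
  have r12: "r1 \<in> Hom C (Dom C r1) (Cod C r1)" "r2 \<in> Hom C (Dom C r1) (Cod C r1)"
    by (simp_all add: in_Hom)
  obtain p1 p2 where jm: "jointly_monic p1 p2" and cp [simp]: "Cod C p1 = Cod C r1"
    and lift: "\<And>x u v. u \<in> Hom C x (Cod C r1) \<Longrightarrow> v \<in> Hom C x (Cod C r1) \<Longrightarrow>
                 \<exists>h \<in> Hom C x (Dom C p1). p1 \<cdot> h = u \<and> p2 \<cdot> h = v"
    by (rule square_ex[OF arr_obj(2)[OF jointly_monic_arr(1)[OF r]]]) blast
  note jointly_monic_arr[OF jm, simp]
  obtain f where f [unfolded in_Hom, simp]: "f \<in> Hom C a (Dom C p1)" and pf: "p1 \<cdot> f = w1" "p2 \<cdot> f = w2"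
    using lift[OF w] by blast
  obtain n where n [unfolded in_Hom, simp]: "n \<in> Hom C (Dom C r1) (Dom C p1)" and pn: "p1 \<cdot> n = r1" "p2 \<cdot> n = r2"
    using lift[OF r12] by blast
  note R = reassoc[OF pf(1)] reassoc[OF pf(2)] reassoc[OF pn(1)] reassoc[OF pn(2)]
  have nm: "mono n"
    unfolding mono_def
  proof (intro conjI allI impI)
    fix t u v assume u: "u \<in> Hom C t (Dom C n)" and v: "v \<in> Hom C t (Dom C n)" and e: "n \<cdot> u = n \<cdot> v"
    have "r1 \<cdot> u = r1 \<cdot> v" "r2 \<cdot> u = r2 \<cdot> v"
      using e R(3,4)[of u] R(3,4)[of v] u v by (simp_all add: in_Hom)
    then show "u = v" by (rule jointly_monicD[OF r, of _ _ t]) (use u v in \<open>auto simp: in_Hom\<close>)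
  qed simp
  obtain m l where pbm: "is_pullback C f n m l" using pullback_ex[of f n] by auto
  note pullback_arr(1-8)[OF pbm, simp]
  have mm: "mono m" using pullback_mono[OF pbm nm] .
  have fx: "f \<cdot> x = n \<cdot> x'"
    by (rule jointly_monicD[OF jm, of _ _ "Dom C x"]) (simp_all add: in_Hom R pf pn)
  obtain mx where mx: "mx \<in> Hom C (Dom C x) (Dom C m)" "m \<cdot> mx = x"
    by (rule pullback_lift[OF pbm _ _ fx]) (assumption | simp (no_asm) add: in_Hom)+
  have fs: "f \<cdot> s = n \<cdot> s'"
    by (rule jointly_monicD[OF jm, of _ _ c]) (simp_all add: in_Hom R pf pn)
  obtain ms where ms: "ms \<in> Hom C c (Dom C m)" "m \<cdot> ms = s"
    by (rule pullback_lift[OF pbm _ _ fs]) (assumption | simp (no_asm) add: in_Hom)+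
  have "is_iso C m"
    by (rule section_and_pullback_cover[OF pt v pb mm _ mx ms]) simp
  then obtain i where i [unfolded in_Hom, simp]: "i \<in> Hom C a (Dom C m)" and mi: "m \<cdot> i = Idn C a"
    by (auto simp: is_iso_def in_Hom)
  have nl: "n \<cdot> (l \<cdot> i) = f"
    using reassoc[OF pullback_arr(9)[OF pbm], of i] mi by simp
  show thesis
  proof (rule that[of "l \<cdot> i"])
    show "r1 \<cdot> l \<cdot> i = w1" using R(3)[of "l \<cdot> i"] nl pf by simp
    show "r2 \<cdot> l \<cdot> i = w2" using R(4)[of "l \<cdot> i"] nl pf by simp
  qed (simp add: in_Hom)
qed

text \<open>
  Protomodular categories are Mal'tsev. In the object of pairs \<open>x R y\<close>, \<open>x R z\<close>, the condition
  \<open>y R z\<close> holds on the diagonal (where it says \<open>y R y\<close>) and on the pairs with \<open>x = y\<close> (where it says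
  \<open>x R z\<close>). The diagonal is a section of the first projection and the second family is a pullback of
  that projection along \<open>x \<mapsto> (x R x)\<close>, so the condition holds everywhere.
\<close>

lemma reflexive_relation_Euclidean:
  assumes r: "jointly_monic r1 r2"
    and d: "d \<in> Hom C (Cod C r1) (Dom C r1)" "r1 \<cdot> d = Idn C (Cod C r1)" "r2 \<cdot> d = Idn C (Cod C r1)"
    and u: "u \<in> Hom C t (Dom C r1)" and v: "v \<in> Hom C t (Dom C r1)" and uv: "r1 \<cdot> u = r1 \<cdot> v"
  obtains w where "w \<in> Hom C t (Dom C r1)" "r1 \<cdot> w = r2 \<cdot> u" "r2 \<cdot> w = r2 \<cdot> v"
proof -
  note jointly_monic_arr[OF r, simp]
  note [simp] = d[unfolded in_Hom] reassoc[OF d(2)] reassoc[OF d(3)]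
  obtain p q where pb: "is_pullback C r1 r1 p q" using pullback_ex[of r1 r1] by auto
  note [simp] = pullback_arr(1,2,4-8)[OF pb]
  note sq = pullback_arr(9)[OF pb] reassoc[OF pullback_arr(9)[OF pb]]
  obtain s where s [unfolded in_Hom, simp]: "s \<in> Hom C (Dom C r1) (Dom C p)"
    and ps [simp]: "p \<cdot> s = Idn C (Dom C r1)" "q \<cdot> s = Idn C (Dom C r1)"
    by (rule pullback_lift[OF pb, of "Idn C (Dom C r1)" "Dom C r1" "Idn C (Dom C r1)"])
      (assumption | simp (no_asm) add: in_Hom)+
  obtain x where x [unfolded in_Hom, simp]: "x \<in> Hom C (Dom C r1) (Dom C p)"
    and px [simp]: "p \<cdot> x = d \<cdot> r1" "q \<cdot> x = Idn C (Dom C r1)"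
    by (rule pullback_lift[OF pb, of "d \<cdot> r1" "Dom C r1" "Idn C (Dom C r1)"]) (assumption | simp (no_asm) add: in_Hom)+
  note [simp] = reassoc[OF px(1)] reassoc[OF px(2)] reassoc[OF ps(1)] reassoc[OF ps(2)]
  have pbx: "is_pullback C p d x r1"
    unfolding is_pullback_def
  proof (intro conjI ballI impI)
    fix y a b assume a: "a \<in> Hom C y (Dom C p)" and b: "b \<in> Hom C y (Dom C d)" and ab: "p \<cdot> a = d \<cdot> b"
    note [simp] = a[unfolded in_Hom] b[unfolded in_Hom]
    have "r1 \<cdot> (d \<cdot> b) = r1 \<cdot> (q \<cdot> a)" using sq(2)[of a] ab by simp
    then have rb: "r1 \<cdot> (q \<cdot> a) = b" by simp
    have xa: "x \<cdot> (q \<cdot> a) = a"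
      by (rule pullback_unique[OF pb, of _ y]) (simp_all add: in_Hom rb ab)
    show "\<exists>!h. h \<in> Hom C y (Dom C x) \<and> x \<cdot> h = a \<and> r1 \<cdot> h = b"
    proof (rule ex1I[of _ "q \<cdot> a"])
      show "q \<cdot> a \<in> Hom C y (Dom C x) \<and> x \<cdot> q \<cdot> a = a \<and> r1 \<cdot> q \<cdot> a = b"
        using xa rb by (simp add: in_Hom)
      fix h assume h: "h \<in> Hom C y (Dom C x) \<and> x \<cdot> h = a \<and> r1 \<cdot> h = b"
      then have "h \<in> Arr C" "Cod C h = Dom C r1" by (simp_all add: in_Hom)
      then have "q \<cdot> (x \<cdot> h) = h" by simp
      then show "h = q \<cdot> a" using h by simp
    qed
  qed (simp_all add: in_Hom)
  obtain l where l [unfolded in_Hom, simp]: "l \<in> Hom C (Dom C p) (Dom C r1)"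
    and rl: "r1 \<cdot> l = r2 \<cdot> p" "r2 \<cdot> l = r2 \<cdot> q"
  proof (rule relation_tested_on_section_and_pullback[OF _ _ pbx r, of "Dom C p" "Dom C r1" s "Cod C r1" "r2 \<cdot> p" "r2 \<cdot> q"
        "Idn C (Dom C r1)" "d \<cdot> r2"])
  qed (simp_all add: in_Hom point_iff)
  obtain h where h [unfolded in_Hom, simp]: "h \<in> Hom C t (Dom C p)" and ph: "p \<cdot> h = u" "q \<cdot> h = v"
    by (rule pullback_lift[OF pb u v uv])
  show thesis
    by (rule that[of "l \<cdot> h"]) (use reassoc[OF rl(1), of h] reassoc[OF rl(2), of h] ph in \<open>simp_all add: in_Hom\<close>)
qed

lemma reflexive_relation_is_equivalence:
  assumes r: "jointly_monic r1 r2"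
    and d: "d \<in> Hom C (Cod C r1) (Dom C r1)" "r1 \<cdot> d = Idn C (Cod C r1)" "r2 \<cdot> d = Idn C (Cod C r1)"
  shows "is_equivalence_relation C r1 r2"
proof -
  note jointly_monic_arr[OF r, simp]
  note [simp] = d[unfolded in_Hom] reassoc[OF d(2)] reassoc[OF d(3)]
  \<comment> \<open>Symmetry: \<open>x R y\<close> and \<open>x R x\<close> give \<open>y R x\<close>.\<close>
  obtain s where s [unfolded in_Hom, simp]: "s \<in> Hom C (Dom C r1) (Dom C r1)"
    and rs': "r1 \<cdot> s = r2 \<cdot> Idn C (Dom C r1)" "r2 \<cdot> s = r2 \<cdot> (d \<cdot> r1)"
    by (rule reflexive_relation_Euclidean[OF r d, of "Idn C (Dom C r1)" "Dom C r1" "d \<cdot> r1"])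
      (assumption | simp (no_asm) add: in_Hom)+
  have rs: "r1 \<cdot> s = r2" "r2 \<cdot> s = r1" using rs' by simp_all
  have trans: "\<exists>t\<in>Hom C (Dom C p) (Dom C r1). r1 \<cdot> t = r1 \<cdot> p \<and> r2 \<cdot> t = r2 \<cdot> q"
    if pb: "is_pullback C r2 r1 p q" for p q
  proof -
    note [simp] = pullback_arr[OF pb]
    obtain t where "t \<in> Hom C (Dom C p) (Dom C r1)" "r1 \<cdot> t = r2 \<cdot> (s \<cdot> p)" "r2 \<cdot> t = r2 \<cdot> q"
      by (rule reflexive_relation_Euclidean[OF r d, of "s \<cdot> p" "Dom C p" q])
        (use reassoc[OF rs(1), of p] in \<open>simp_all add: in_Hom\<close>)
    then show ?thesis using reassoc[OF rs(2), of p] by auto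
  qed
  show ?thesis
    unfolding is_equivalence_relation_def
  proof (intro conjI)
    show "\<exists>d\<in>Hom C (Cod C r1) (Dom C r1). r1 \<cdot> d = Idn C (Cod C r1) \<and> r2 \<cdot> d = Idn C (Cod C r1)"
      using d by blast
    show "\<exists>s\<in>Hom C (Dom C r1) (Dom C r1). r1 \<cdot> s = r2 \<and> r2 \<cdot> s = r1"
      by (rule bexI[of _ s]) (simp_all add: in_Hom rs)
    show "\<forall>x\<in>Obj C. \<forall>u\<in>Hom C x (Dom C r1). \<forall>v\<in>Hom C x (Dom C r1).
        r1 \<cdot> u = r1 \<cdot> v \<longrightarrow> r2 \<cdot> u = r2 \<cdot> v \<longrightarrow> u = v"
      using r unfolding jointly_monic_def by blast
  qed (use trans in \<open>simp_all add: in_Hom\<close>)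
qed

end

section \<open>Coproducts and kernels in semi-abelian categories\<close>

locale semi_abelian_cat = category C for C :: "('o, 'm) cat" (structure) +
  fixes S :: "('o, 'm) choices"
  assumes semi_abelian: "semi_abelian C" and valid: "valid_choices C S"

sublocale semi_abelian_cat \<subseteq> regular_cat
  using semi_abelian by unfold_locales (auto simp: semi_abelian_def barr_exact_def regular_category_def)

sublocale semi_abelian_cat \<subseteq> protomodular_cat
  using semi_abelian by unfold_locales (auto simp: semi_abelian_def)

context semi_abelian_cat
begin

lemma zob: "is_initial C (zob S)" "is_terminal C (zob S)" "zob S \<in> Obj C"
  using valid by (auto simp: valid_choices_def is_zero_object_def is_initial_def)

lemma zero_mor_eq:
  assumes z: "is_zero_object C z" and g: "g \<in> Hom C a z" and h: "h \<in> Hom C z b"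
  shows "zero_mor C a b = h \<cdot> g"
  unfolding zero_mor_def
proof (rule the_equality)
  show "\<exists>z g' h'. is_zero_object C z \<and> g' \<in> Hom C a z \<and> h' \<in> Hom C z b \<and> h \<cdot> g = h' \<cdot> g'"
    using assms by blast
  fix f assume "\<exists>z g h. is_zero_object C z \<and> g \<in> Hom C a z \<and> h \<in> Hom C z b \<and> f = h \<cdot> g"
  then obtain y g' h' where y: "is_zero_object C y" and g': "g' \<in> Hom C a y" and h': "h' \<in> Hom C y b"
    and f: "f = h' \<cdot> g'" by blast
  have ab: "a \<in> Obj C" "b \<in> Obj C" "y \<in> Obj C" using g h g' Hom_obj by blast+
  obtain i where i: "i \<in> Hom C z y" using z ab by (auto simp: is_zero_object_def is_initial_def)
  have "i \<cdot> g \<in> Hom C a y" using i g by (auto simp: in_Hom)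
  then have ig: "i \<cdot> g = g'" using g' y ab unfolding is_zero_object_def is_terminal_def by blast
  have "h' \<cdot> i \<in> Hom C z b" using i h' by (auto simp: in_Hom)
  then have hi: "h' \<cdot> i = h" using h z ab unfolding is_zero_object_def is_initial_def by blast
  show "f = h \<cdot> g" unfolding f ig[symmetric] hi[symmetric] using i g h' by (simp add: in_Hom)
qed

lemma zero_mor_factors:
  assumes "a \<in> Obj C" "b \<in> Obj C"
  obtains g h where "g \<in> Hom C a (zob S)" "h \<in> Hom C (zob S) b" "zero_mor C a b = h \<cdot> g"
proof -
  obtain g h where "g \<in> Hom C a (zob S)" "h \<in> Hom C (zob S) b"
    using zob assms unfolding is_initial_def is_terminal_def by blast
  then show thesis using that zero_mor_eq valid unfolding valid_choices_def by blast
qed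

lemma zero_mor [simp]:
  assumes "a \<in> Obj C" "b \<in> Obj C"
  shows "zero_mor C a b \<in> Arr C" "Dom C (zero_mor C a b) = a" "Cod C (zero_mor C a b) = b"
  by (rule zero_mor_factors[OF assms], auto simp: in_Hom)+

lemma cmp_zero_mor [simp]:
  assumes "a \<in> Obj C" "b \<in> Obj C"
  shows "f \<in> Arr C \<Longrightarrow> Dom C f = b \<Longrightarrow> f \<cdot> zero_mor C a b = zero_mor C a (Cod C f)"
    and "f \<in> Arr C \<Longrightarrow> Cod C f = a \<Longrightarrow> zero_mor C a b \<cdot> f = zero_mor C (Dom C f) b"
proof -
  obtain g h where gh: "g \<in> Hom C a (zob S)" "h \<in> Hom C (zob S) b" "zero_mor C a b = h \<cdot> g"
    using zero_mor_factors assms by blast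
  have z: "is_zero_object C (zob S)" using valid by (simp add: valid_choices_def)
  show "f \<cdot> zero_mor C a b = zero_mor C a (Cod C f)" if "f \<in> Arr C" "Dom C f = b"
    using zero_mor_eq[OF z, of g a "f \<cdot> h" "Cod C f"] gh that by (simp add: in_Hom)
  show "zero_mor C a b \<cdot> f = zero_mor C (Dom C f) b" if "f \<in> Arr C" "Cod C f = a"
    using zero_mor_eq[OF z, of "g \<cdot> f" "Dom C f" h b] gh that by (simp add: in_Hom)
qed

lemma kernel_arr:
  assumes "is_kernel C k f"
  shows "k \<in> Arr C" "f \<in> Arr C" "Cod C k = Dom C f" "f \<cdot> k = zero_mor C (Dom C k) (Cod C f)"
  using assms by (auto simp: is_kernel_def in_Hom)

lemma kernel_lift_unique:
  assumes "is_kernel C k f" "u \<in> Hom C x (Dom C f)" "f \<cdot> u = zero_mor C x (Cod C f)"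
  shows "\<exists>!h. h \<in> Hom C x (Dom C k) \<and> k \<cdot> h = u"
  using assms Hom_obj[OF assms(2)] unfolding is_kernel_def by blast

lemma kernel_mono:
  assumes "is_kernel C k f"
  shows "mono k"
  unfolding mono_def
proof (intro conjI allI impI)
  note [simp] = kernel_arr[OF assms]
  show "k \<in> Arr C" by simp
  fix t u v assume u: "u \<in> Hom C t (Dom C k)" and v: "v \<in> Hom C t (Dom C k)" and e: "k \<cdot> u = k \<cdot> v"
  have "f \<cdot> (k \<cdot> v) = zero_mor C t (Cod C f)"
    using v reassoc[OF kernel_arr(4)[OF assms], of v] by (simp add: in_Hom)
  then have "\<exists>!h. h \<in> Hom C t (Dom C k) \<and> k \<cdot> h = k \<cdot> v"
    using v by (intro kernel_lift_unique[OF assms]) (auto simp: in_Hom)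
  then show "u = v" using u v e by blast
qed

lemma inj_coproduct:
  assumes "a \<in> Obj C" "b \<in> Obj C"
  shows "is_coproduct C a b (in1 S a b) (in2 S a b)"
  using valid assms by (auto simp: valid_choices_def)

lemma inj [simp]:
  assumes "a \<in> Obj C" "b \<in> Obj C"
  shows "in1 S a b \<in> Arr C" "Dom C (in1 S a b) = a" "Cod C (in1 S a b) = cop C S a b"
    "in2 S a b \<in> Arr C" "Dom C (in2 S a b) = b" "Cod C (in2 S a b) = cop C S a b" "cop C S a b \<in> Obj C"
  using inj_coproduct[OF assms] by (auto simp: is_coproduct_def in_Hom cop_def)

lemma copair_ex1:
  assumes "f \<in> Arr C" "g \<in> Arr C" "Cod C f = Cod C g"
  shows "\<exists>!h. h \<in> Hom C (cop C S (Dom C f) (Dom C g)) (Cod C f) \<and>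
    h \<cdot> in1 S (Dom C f) (Dom C g) = f \<and> h \<cdot> in2 S (Dom C f) (Dom C g) = g"
  using inj_coproduct[of "Dom C f" "Dom C g"] assms unfolding is_coproduct_def cop_def
  by (auto simp: in_Hom)

lemma copair [simp]:
  assumes "f \<in> Arr C" "g \<in> Arr C" "Cod C f = Cod C g"
  shows "copair C S f g \<in> Arr C" "Dom C (copair C S f g) = cop C S (Dom C f) (Dom C g)"
    "Cod C (copair C S f g) = Cod C g"
    "Dom C f = a \<Longrightarrow> Dom C g = b \<Longrightarrow> copair C S f g \<cdot> in1 S a b = f"
    "Dom C f = a \<Longrightarrow> Dom C g = b \<Longrightarrow> copair C S f g \<cdot> in2 S a b = g"
  using theI'[OF copair_ex1[OF assms]] assms(3) unfolding copair_def[symmetric] by (auto simp: in_Hom)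

lemma copair_reassoc [simp]:
  assumes "f \<in> Arr C" "g \<in> Arr C" "Cod C f = Cod C g" "Dom C f = a" "Dom C g = b"
    "x \<in> Arr C"
  shows "Cod C x = a \<Longrightarrow> copair C S f g \<cdot> (in1 S a b \<cdot> x) = f \<cdot> x"
    "Cod C x = b \<Longrightarrow> copair C S f g \<cdot> (in2 S a b \<cdot> x) = g \<cdot> x"
  by (rule reassoc; use assms arr_obj in force)+

lemma cop_ext:
  assumes "h \<in> Hom C (cop C S a b) x" "h' \<in> Hom C (cop C S a b) x" "a \<in> Obj C" "b \<in> Obj C"
    "h \<cdot> in1 S a b = h' \<cdot> in1 S a b" "h \<cdot> in2 S a b = h' \<cdot> in2 S a b"
  shows "h = h'"
proof -
  have "Dom C (h' \<cdot> in1 S a b) = a" "Dom C (h' \<cdot> in2 S a b) = b" "Cod C (h' \<cdot> in1 S a b) = x"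
    using assms by (auto simp: in_Hom)
  then show ?thesis
    using copair_ex1[of "h' \<cdot> in1 S a b" "h' \<cdot> in2 S a b"] assms by (auto simp: in_Hom)
qed

lemma cmp_copair:
  assumes "f \<in> Hom C a x" "g \<in> Hom C b x" "h \<in> Hom C x y"
  shows "h \<cdot> copair C S f g = copair C S (h \<cdot> f) (h \<cdot> g)"
  by (rule cop_ext[of _ a b y])
    (use assms Hom_obj[OF assms(1)] Hom_obj[OF assms(2)] in \<open>auto simp: in_Hom\<close>)

abbreviation retraction :: "'o \<Rightarrow> 'o \<Rightarrow> 'm" where
  "retraction c x \<equiv> copair C S (Idn C c) (zero_mor C x c)"

lemma ker_kernel:
  assumes "c \<in> Obj C" "x \<in> Obj C"
  shows "is_kernel C (ker S c x) (retraction c x)"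
  using valid assms by (auto simp: valid_choices_def)

lemma ker [simp]:
  assumes "c \<in> Obj C" "x \<in> Obj C"
  shows "ker S c x \<in> Arr C" "Dom C (ker S c x) = flat C S c x" "Cod C (ker S c x) = cop C S c x"
    "flat C S c x \<in> Obj C" "retraction c x \<cdot> ker S c x = zero_mor C (flat C S c x) c"
  using kernel_arr[OF ker_kernel[OF assms]] assms by (auto simp: flat_def)

lemma ker_cancel:
  assumes "c \<in> Obj C" "x \<in> Obj C" "ker S c x \<cdot> u = ker S c x \<cdot> v"
    "u \<in> Hom C t (flat C S c x)" "v \<in> Hom C t (flat C S c x)"
  shows "u = v"
  using monoD[OF kernel_mono[OF ker_kernel[OF assms(1,2)]] assms(3)] assms by auto

lemma ker_lift_ex1:
  assumes "c \<in> Obj C" "x \<in> Obj C" "u \<in> Hom C t (cop C S c x)" "retraction c x \<cdot> u = zero_mor C t c"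
  shows "\<exists>!h. h \<in> Hom C t (flat C S c x) \<and> ker S c x \<cdot> h = u"
  using kernel_lift_unique[OF ker_kernel[OF assms(1,2)], of u t] assms by simp

lemma cop_map [simp]:
  assumes "g \<in> Arr C" "f \<in> Arr C"
  shows "cop_map C S g f \<in> Arr C" "Dom C (cop_map C S g f) = cop C S (Dom C g) (Dom C f)"
    "Cod C (cop_map C S g f) = cop C S (Cod C g) (Cod C f)"
  using assms by (auto simp: cop_map_def)

lemma retraction_cop_map:
  assumes "g \<in> Arr C" "f \<in> Arr C"
  shows "retraction (Cod C g) (Cod C f) \<cdot> cop_map C S g f = g \<cdot> retraction (Dom C g) (Dom C f)"
  by (rule cop_ext[of _ "Dom C g" "Dom C f" "Cod C g"]) (use assms in \<open>auto simp: in_Hom cop_map_def\<close>)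

lemma flat_map:
  assumes "g \<in> Arr C" "f \<in> Arr C"
  shows "flat_map C S g f \<in> Hom C (flat C S (Dom C g) (Dom C f)) (flat C S (Cod C g) (Cod C f))"
    "ker S (Cod C g) (Cod C f) \<cdot> flat_map C S g f = cop_map C S g f \<cdot> ker S (Dom C g) (Dom C f)"
proof -
  have "retraction (Cod C g) (Cod C f) \<cdot> (cop_map C S g f \<cdot> ker S (Dom C g) (Dom C f))
      = zero_mor C (flat C S (Dom C g) (Dom C f)) (Cod C g)"
    using assms reassoc[OF retraction_cop_map[OF assms], of "ker S (Dom C g) (Dom C f)"] by simp
  then have "\<exists>!h. h \<in> Hom C (flat C S (Dom C g) (Dom C f)) (flat C S (Cod C g) (Cod C f)) \<and>
      ker S (Cod C g) (Cod C f) \<cdot> h = cop_map C S g f \<cdot> ker S (Dom C g) (Dom C f)"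
    using assms by (intro ker_lift_ex1) (auto simp: in_Hom)
  from theI'[OF this]
  show "flat_map C S g f \<in> Hom C (flat C S (Dom C g) (Dom C f)) (flat C S (Cod C g) (Cod C f))"
    "ker S (Cod C g) (Cod C f) \<cdot> flat_map C S g f = cop_map C S g f \<cdot> ker S (Dom C g) (Dom C f)"
    unfolding flat_map_def[symmetric] by auto
qed

lemma flat_unit:
  assumes "c \<in> Obj C" "x \<in> Obj C"
  shows "flat_unit C S c x \<in> Hom C x (flat C S c x)" "ker S c x \<cdot> flat_unit C S c x = in2 S c x"
proof -
  have "\<exists>!h. h \<in> Hom C x (flat C S c x) \<and> ker S c x \<cdot> h = in2 S c x"
    using assms by (intro ker_lift_ex1) (auto simp: in_Hom)
  from theI'[OF this]
  show "flat_unit C S c x \<in> Hom C x (flat C S c x)" "ker S c x \<cdot> flat_unit C S c x = in2 S c x"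
    unfolding flat_unit_def[symmetric] by auto
qed

lemma flat_mult:
  assumes "c \<in> Obj C" "x \<in> Obj C"
  shows "flat_mult C S c x \<in> Hom C (flat C S c (flat C S c x)) (flat C S c x)"
    "ker S c x \<cdot> flat_mult C S c x = copair C S (in1 S c x) (ker S c x) \<cdot> ker S c (flat C S c x)"
proof -
  have "retraction c x \<cdot> copair C S (in1 S c x) (ker S c x) = retraction c (flat C S c x)"
    using assms by (subst cmp_copair[of _ c "cop C S c x" _ "flat C S c x" _ c]) (auto simp: in_Hom)
  from reassoc[OF this, of "ker S c (flat C S c x)"]
  have "\<exists>!h. h \<in> Hom C (flat C S c (flat C S c x)) (flat C S c x) \<and>
      ker S c x \<cdot> h = copair C S (in1 S c x) (ker S c x) \<cdot> ker S c (flat C S c x)"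
    using assms by (intro ker_lift_ex1) (auto simp: in_Hom)
  from theI'[OF this]
  show "flat_mult C S c x \<in> Hom C (flat C S c (flat C S c x)) (flat C S c x)"
    "ker S c x \<cdot> flat_mult C S c x = copair C S (in1 S c x) (ker S c x) \<cdot> ker S c (flat C S c x)"
    unfolding flat_mult_def[symmetric] by auto
qed

section \<open>Semidirect products\<close>

lemma effective_quotient:
  assumes "is_equivalence_relation C r1 r2"
  obtains q where "is_coequalizer C r1 r2 q" "is_kernel_pair C q r1 r2"
proof -
  obtain f where f: "is_kernel_pair C f r1 r2"
    using semi_abelian assms unfolding semi_abelian_def barr_exact_def by blast
  obtain q where "is_coequalizer C r1 r2 q"
    using regular f unfolding regular_category_def by blast
  then show thesis using that coequalizer_of_kernel_pair_has_same_kernel_pair[OF f] by blast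
qed

text \<open>
  Every action comes from a point, its semidirect product. In groups this is the quotient of the free
  product \<open>c + x\<close> in which each conjugate of an element of \<open>x\<close> by one of \<open>c\<close> is identified with the
  value of \<open>\<xi>\<close> on it: the coequalizer \<open>q\<close> of \<open>in2 \<cdot> \<xi>\<close> and \<open>\<kappa>\<close>. To control its kernel, \<open>q\<close> is
  presented as the coequalizer of the reflexive pair \<open>c + \<xi>, [in1, \<kappa>] : c + (c \<flat> x) \<rightarrow> c + x\<close>. The
  image \<open>R\<close> of this pair is a reflexive relation, hence an effective equivalence relation, and so the
  elements identified by \<open>q\<close> are exactly those related by \<open>R\<close>. These are covered by elements of
  \<open>c + (c \<flat> x)\<close>, and over the kernel of the retraction to \<open>c\<close> by elements \<open>w\<close> of
  \<open>c \<flat> (c \<flat> x)\<close>. There the two legs are \<open>c \<flat> \<xi>\<close> and the multiplication, which agree after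
  \<open>\<xi>\<close>; so \<open>q\<close> is monic on \<open>x\<close>.
\<close>

theorem internal_action_has_associated_point:
  assumes c [simp]: "c \<in> Obj C" and act: "is_internal_action C S c x \<xi>"
  obtains a p s where "is_associated C S c x \<xi> a p s"
proof -
  define K where "K = flat C S c x"
  define Y where "Y = cop C S c x"
  define \<kappa> where "\<kappa> = ker S c x"
  define \<kappa>' where "\<kappa>' = ker S c K"
  define i1 where "i1 = in1 S c x"
  define i2 where "i2 = in2 S c x"
  define j1 where "j1 = in1 S c K"
  define j2 where "j2 = in2 S c K"
  define \<pi> where "\<pi> = retraction c x"
  define \<pi>' where "\<pi>' = retraction c K"
  define u where "u = flat_unit C S c x"
  define \<mu> where "\<mu> = flat_mult C S c x"
  define T\<xi> where "T\<xi> = flat_map C S (Idn C c) \<xi>"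
  define g1 where "g1 = cop_map C S (Idn C c) \<xi>"
  define g2 where "g2 = copair C S i1 \<kappa>"
  have act': "x \<in> Obj C" "\<xi> \<in> Hom C K x" "\<xi> \<cdot> u = Idn C x" "\<xi> \<cdot> T\<xi> = \<xi> \<cdot> \<mu>"
    using act unfolding is_internal_action_def is_algebra_def flat_ftor_def K_def u_def \<mu>_def T\<xi>_def
    by simp_all
  note [simp] = act'(1) act'(2)[unfolded in_Hom]
  have K [simp]: "K \<in> Obj C" "Y \<in> Obj C" by (simp_all add: K_def Y_def)
  have [simp]: "\<kappa> \<in> Arr C" "Dom C \<kappa> = K" "Cod C \<kappa> = Y" by (simp_all add: \<kappa>_def K_def Y_def)
  have [simp]: "\<kappa>' \<in> Arr C" "Cod C \<kappa>' = cop C S c K" by (simp_all add: \<kappa>'_def)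
  have [simp]: "i1 \<in> Arr C" "Dom C i1 = c" "Cod C i1 = Y" "i2 \<in> Arr C" "Dom C i2 = x" "Cod C i2 = Y"
    by (simp_all add: i1_def i2_def Y_def)
  have [simp]: "j1 \<in> Arr C" "Dom C j1 = c" "Cod C j1 = cop C S c K"
    "j2 \<in> Arr C" "Dom C j2 = K" "Cod C j2 = cop C S c K"
    by (simp_all add: j1_def j2_def)
  have [simp]: "\<pi> \<in> Arr C" "Dom C \<pi> = Y" "Cod C \<pi> = c" "\<pi>' \<in> Arr C" "Dom C \<pi>' = cop C S c K" "Cod C \<pi>' = c"
    by (simp_all add: \<pi>_def \<pi>'_def Y_def)
  have [simp]: "u \<in> Arr C" "Dom C u = x" "Cod C u = K" and \<kappa>u: "\<kappa> \<cdot> u = i2"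
    using flat_unit[of c x] by (simp_all add: u_def \<kappa>_def i2_def K_def in_Hom)
  have \<mu> [simp]: "\<mu> \<in> Arr C" "Dom C \<mu> = Dom C \<kappa>'" "Cod C \<mu> = K" and \<kappa>\<mu>: "\<kappa> \<cdot> \<mu> = g2 \<cdot> \<kappa>'"
    using flat_mult[of c x] by (simp_all add: \<mu>_def \<kappa>_def \<kappa>'_def g2_def i1_def K_def in_Hom)
  have T\<xi> [simp]: "T\<xi> \<in> Arr C" "Dom C T\<xi> = Dom C \<kappa>'" "Cod C T\<xi> = K" and \<kappa>T\<xi>: "\<kappa> \<cdot> T\<xi> = g1 \<cdot> \<kappa>'"
    using flat_map[of "Idn C c" \<xi>]
    by (simp_all add: T\<xi>_def \<kappa>_def \<kappa>'_def g1_def K_def[symmetric] in_Hom)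
  have g1 [simp]: "g1 \<in> Arr C" "Dom C g1 = cop C S c K" "Cod C g1 = Y"
    by (simp_all add: g1_def Y_def)
  have g2 [simp]: "g2 \<in> Arr C" "Dom C g2 = cop C S c K" "Cod C g2 = Y"
    by (simp_all add: g2_def)
  have g1j: "g1 \<cdot> j1 = i1" "g1 \<cdot> j2 = i2 \<cdot> \<xi>"
    by (simp_all add: g1_def cop_map_def j1_def j2_def flip: i1_def i2_def)
  have g2j: "g2 \<cdot> j1 = i1" "g2 \<cdot> j2 = \<kappa>"
    by (simp_all add: g2_def j1_def j2_def)
  have \<pi>i: "\<pi> \<cdot> i1 = Idn C c" "\<pi> \<cdot> i2 = zero_mor C x c" "\<pi> \<cdot> \<kappa> = zero_mor C K c"
    by (simp_all add: \<pi>_def i1_def i2_def \<kappa>_def K_def)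
  have \<pi>'j: "\<pi>' \<cdot> j1 = Idn C c" "\<pi>' \<cdot> j2 = zero_mor C K c"
    by (simp_all add: \<pi>'_def j1_def j2_def)
  have ext: "h = h'" if "h \<in> Arr C" "h' \<in> Arr C" "Dom C h = cop C S c K" "Dom C h' = cop C S c K"
    "Cod C h = z" "Cod C h' = z" "h \<cdot> j1 = h' \<cdot> j1" "h \<cdot> j2 = h' \<cdot> j2" for h h' z
    using cop_ext[of h c K z h'] that by (simp add: in_Hom j1_def j2_def)
  have extY: "h = h'" if "h \<in> Arr C" "h' \<in> Arr C" "Dom C h = Y" "Dom C h' = Y"
    "Cod C h = z" "Cod C h' = z" "h \<cdot> i1 = h' \<cdot> i1" "h \<cdot> i2 = h' \<cdot> i2" for h h' z
    using cop_ext[of h c x z h'] that by (simp add: in_Hom i1_def i2_def Y_def)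
  have \<pi>g1: "\<pi> \<cdot> g1 = \<pi>'"
    by (rule ext[of _ _ c]) (simp_all add: g1j \<pi>'j \<pi>i reassoc[OF \<pi>i(2)])
  have \<pi>g2: "\<pi> \<cdot> g2 = \<pi>'"
    by (rule ext[of _ _ c]) (simp_all add: g2j \<pi>'j \<pi>i)
  have "g2 \<in> Hom C (Dom C g1) (Cod C g1)" by (simp add: in_Hom)
  then obtain e r1 r2 where e: "is_regular_epi C e" and de: "Dom C e = Dom C g1" and jm: "jointly_monic r1 r2"
    and rh: "r1 \<in> Hom C (Cod C e) (Cod C g1)" "r2 \<in> Hom C (Cod C e) (Cod C g1)"
    and re: "r1 \<cdot> e = g1" "r2 \<cdot> e = g2"
    by (rule image_relation[OF g1(1)])
  note [simp] = regular_epi_arr[OF e] de rh[unfolded in_Hom]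
  \<comment> \<open>\<open>d = c + u\<close> is a common section of the two legs, by the unit law of \<open>\<xi>\<close> and by
    \<open>\<kappa> \<cdot> u = in2\<close>; it makes the image reflexive.\<close>
  define d where "d = copair C S j1 (j2 \<cdot> u)"
  have [simp]: "d \<in> Arr C" "Dom C d = Y" "Cod C d = cop C S c K" by (simp_all add: d_def Y_def)
  have di: "d \<cdot> i1 = j1" "d \<cdot> i2 = j2 \<cdot> u" by (simp_all add: d_def i1_def i2_def)
  have g1d: "g1 \<cdot> d = Idn C Y"
    by (rule extY[of _ _ Y]) (simp_all add: di g1j reassoc[OF g1j(2)] act')
  have g2d: "g2 \<cdot> d = Idn C Y"
    by (rule extY[of _ _ Y]) (simp_all add: di g2j reassoc[OF g2j(2)] \<kappa>u)
  have eq: "is_equivalence_relation C r1 r2"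
    by (rule reflexive_relation_is_equivalence[OF jm, of "e \<cdot> d"])
      (simp_all add: in_Hom reassoc[OF re(1)] reassoc[OF re(2)] g1d g2d)
  obtain q where cq: "is_coequalizer C r1 r2 q" and kq: "is_kernel_pair C q r1 r2"
    by (rule effective_quotient[OF eq])
  have q: "is_regular_epi C q" using cq by (auto simp: is_regular_epi_def)
  note kq' = kq[unfolded is_kernel_pair_def]
  have [simp]: "q \<in> Arr C" "Dom C q = Y" using coequalizer_arr[OF cq] by simp_all
  have qg: "q \<cdot> g1 = q \<cdot> g2"
    using reassoc[OF coequalizer_arr(7)[OF cq], of e] by (simp add: re)
  \<comment> \<open>The retraction to \<open>c\<close> does not distinguish the two legs, so it descends to the quotient.\<close>
  have "\<pi> \<cdot> r1 = \<pi> \<cdot> r2"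
    by (rule regular_epi_cancel[OF e, of _ _ c]) (simp_all add: in_Hom re \<pi>g1 \<pi>g2)
  then obtain p where p: "p \<in> Hom C (Cod C q) c" and pq: "p \<cdot> q = \<pi>"
    using coequalizer_descend[OF cq, of \<pi> c] by (auto simp: in_Hom)
  note [simp] = p[unfolded in_Hom]
  define s where "s = q \<cdot> i1"
  define k where "k = q \<cdot> i2"
  have [simp]: "s \<in> Arr C" "Dom C s = c" "Cod C s = Cod C q" "k \<in> Arr C" "Dom C k = x" "Cod C k = Cod C q"
    by (simp_all add: s_def k_def)
  have pt: "is_point C (Cod C q) c p s"
    by (simp add: point_iff) (simp add: s_def reassoc[OF pq] \<pi>i)
  have k\<xi>: "k \<cdot> \<xi> = q \<cdot> \<kappa>"
    using reassoc[OF qg, of j2] by (simp add: k_def g1j g2j)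
  have sk: "copair C S s k = q"
    by (rule extY[of _ _ "Cod C q"])
      (simp_all add: Y_def i1_def i2_def flip: s_def[unfolded i1_def] k_def[unfolded i2_def])
  \<comment> \<open>If \<open>q\<close> identifies two elements \<open>a\<close>, \<open>b\<close> of \<open>x\<close>, then on a cover they come from a single
    element \<open>w\<close> of \<open>c \<flat> (c \<flat> x)\<close>, as its images under \<open>c \<flat> \<xi>\<close> and the multiplication.\<close>
  have "mono k"
    unfolding mono_def
  proof (intro conjI allI impI)
    fix t a b assume a: "a \<in> Hom C t (Dom C k)" and b: "b \<in> Hom C t (Dom C k)" and ab: "k \<cdot> a = k \<cdot> b"
    have [simp]: "a \<in> Arr C" "Dom C a = t" "Cod C a = x" "b \<in> Arr C" "Dom C b = t" "Cod C b = x"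
      using a b by (simp_all add: in_Hom)
    have [simp]: "t \<in> Obj C" using Hom_obj[OF a] by simp
    have qab: "q \<cdot> (i2 \<cdot> a) = q \<cdot> (i2 \<cdot> b)" using ab by (simp add: k_def)
    obtain r where r: "r \<in> Hom C t (Dom C r1)" and rr: "r1 \<cdot> r = i2 \<cdot> a" "r2 \<cdot> r = i2 \<cdot> b"
      by (rule pullback_lift[OF kq' _ _ qab]) (assumption | simp (no_asm) add: in_Hom)+
    note [simp] = r[unfolded in_Hom]
    obtain v g where v: "is_regular_epi C v" and cv: "Cod C v = t" and g: "g \<in> Hom C (Dom C v) (Dom C e)"
      and eg: "e \<cdot> g = r \<cdot> v"
      by (rule regular_epi_cover[OF e, of r t]) (assumption | simp (no_asm) add: in_Hom)+
    note [simp] = regular_epi_arr[OF v] cv g[unfolded in_Hom]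
    have g1g: "g1 \<cdot> g = i2 \<cdot> (a \<cdot> v)"
      using reassoc[OF re(1), of g] reassoc[OF rr(1), of v] eg by simp
    have g2g: "g2 \<cdot> g = i2 \<cdot> (b \<cdot> v)"
      using reassoc[OF re(2), of g] reassoc[OF rr(2), of v] eg by simp
    have "\<pi>' \<cdot> g = \<pi> \<cdot> (g1 \<cdot> g)" using reassoc[OF \<pi>g1, of g] by simp
    also have "\<dots> = zero_mor C (Dom C v) c" by (simp add: g1g reassoc[OF \<pi>i(2)])
    finally obtain w where w: "w \<in> Hom C (Dom C v) (Dom C \<kappa>')" and \<kappa>w: "\<kappa>' \<cdot> w = g"
      using ker_lift_ex1[of c K g "Dom C v"] by (auto simp: in_Hom \<pi>'_def \<kappa>'_def)
    note [simp] = w[unfolded in_Hom]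
    have "T\<xi> \<cdot> w = u \<cdot> (a \<cdot> v)"
    proof (rule ker_cancel[of c x _ _ "Dom C v"])
      show "ker S c x \<cdot> T\<xi> \<cdot> w = ker S c x \<cdot> u \<cdot> a \<cdot> v"
        using reassoc[OF \<kappa>T\<xi>, of w] reassoc[OF \<kappa>u, of "a \<cdot> v"] \<kappa>w g1g by (simp flip: \<kappa>_def)
    qed (simp_all add: in_Hom flip: K_def)
    moreover have "\<mu> \<cdot> w = u \<cdot> (b \<cdot> v)"
    proof (rule ker_cancel[of c x _ _ "Dom C v"])
      show "ker S c x \<cdot> \<mu> \<cdot> w = ker S c x \<cdot> u \<cdot> b \<cdot> v"
        using reassoc[OF \<kappa>\<mu>, of w] reassoc[OF \<kappa>u, of "b \<cdot> v"] \<kappa>w g2g by (simp flip: \<kappa>_def)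
    qed (simp_all add: in_Hom flip: K_def)
    ultimately have "\<xi> \<cdot> (u \<cdot> (a \<cdot> v)) = \<xi> \<cdot> (u \<cdot> (b \<cdot> v))"
      using reassoc[OF act'(4), of w] by simp
    then have "a \<cdot> v = b \<cdot> v" by (simp add: reassoc[OF act'(3)])
    then show "a = b" by (rule regular_epi_cancel[OF v, of _ _ x]) (simp_all add: in_Hom)
  qed simp
  \<comment> \<open>An element \<open>a\<close> of the kernel of \<open>p\<close> lifts on a cover to an element \<open>w\<close> of \<open>c \<flat> x\<close>, and
    \<open>k\<close> maps \<open>\<xi> \<cdot> w\<close> to it. As \<open>k\<close> is monic, \<open>\<xi> \<cdot> w\<close> descends from the cover.\<close>
  have "is_kernel C k p"
    unfolding is_kernel_def
  proof (intro conjI ballI impI)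
    show "p \<cdot> k = zero_mor C (Dom C k) (Cod C p)" by (simp add: k_def reassoc[OF pq] \<pi>i)
    fix t a assume "t \<in> Obj C" and a: "a \<in> Hom C t (Dom C p)" and pa: "p \<cdot> a = zero_mor C t (Cod C p)"
    have [simp]: "a \<in> Arr C" "Dom C a = t" "Cod C a = Cod C q" "t \<in> Obj C"
      using a \<open>t \<in> Obj C\<close> by (simp_all add: in_Hom)
    obtain v y where v: "is_regular_epi C v" and cv: "Cod C v = t" and y: "y \<in> Hom C (Dom C v) (Dom C q)"
      and qy: "q \<cdot> y = a \<cdot> v"
      by (rule regular_epi_cover[OF q, of a t]) (assumption | simp (no_asm) add: in_Hom)+
    note [simp] = regular_epi_arr[OF v] cv y[unfolded in_Hom]
    have "\<pi> \<cdot> y = p \<cdot> (a \<cdot> v)" using reassoc[OF pq, of y] qy by simp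
    also have "\<dots> = zero_mor C (Dom C v) c" using reassoc[OF pa, of v] by simp
    finally obtain w where w: "w \<in> Hom C (Dom C v) K" and \<kappa>w: "\<kappa> \<cdot> w = y"
      using ker_lift_ex1[of c x y "Dom C v"] by (auto simp: in_Hom \<pi>_def \<kappa>_def K_def Y_def)
    note [simp] = w[unfolded in_Hom]
    have k\<xi>w: "k \<cdot> (\<xi> \<cdot> w) = a \<cdot> v" using reassoc[OF k\<xi>, of w] \<kappa>w qy by simp
    obtain h where h: "h \<in> Hom C (Cod C v) x" and hv: "h \<cdot> v = \<xi> \<cdot> w"
    proof (rule regular_epi_descend[OF v, of "\<xi> \<cdot> w" x])
      fix z b b' assume b: "b \<in> Hom C z (Dom C v)" and b': "b' \<in> Hom C z (Dom C v)" and bb: "v \<cdot> b = v \<cdot> b'"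
      note bs = b[unfolded in_Hom] b'[unfolded in_Hom]
      have "k \<cdot> ((\<xi> \<cdot> w) \<cdot> b) = k \<cdot> ((\<xi> \<cdot> w) \<cdot> b')"
        using reassoc[OF k\<xi>w, of b] reassoc[OF k\<xi>w, of b'] bb by (simp add: bs)
      then show "(\<xi> \<cdot> w) \<cdot> b = (\<xi> \<cdot> w) \<cdot> b'"
        by (rule monoD[OF \<open>mono k\<close>, of _ _ z]) (simp_all add: in_Hom bs)
    qed (simp add: in_Hom, assumption)
    note [simp] = h[unfolded in_Hom]
    have kh: "k \<cdot> h = a"
      by (rule regular_epi_cancel[OF v, of _ _ "Cod C q"]) (simp_all add: in_Hom hv k\<xi>w)
    show "\<exists>!h. h \<in> Hom C t (Dom C k) \<and> k \<cdot> h = a"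
    proof (rule ex1I[of _ h])
      fix h' assume h': "h' \<in> Hom C t (Dom C k) \<and> k \<cdot> h' = a"
      show "h' = h"
      proof (rule monoD[OF \<open>mono k\<close>, of _ _ t])
        show "k \<cdot> h' = k \<cdot> h" using h' kh by metis
        show "h' \<in> Hom C t (Dom C k)" using h' by blast
      qed (simp add: in_Hom)
    qed (simp add: in_Hom kh)
  qed (simp_all add: in_Hom)
  moreover have "k \<in> Hom C x (Cod C q)" by (simp add: in_Hom)
  moreover have "k \<cdot> \<xi> = copair C S s k \<cdot> ker S c x" using k\<xi> sk by (simp add: \<kappa>_def)
  ultimately have "is_associated C S c x \<xi> (Cod C q) p s"
    unfolding is_associated_def using pt by blast
  then show thesis by (rule that)
qed


text \<open>
  As \<open>[s, k] \<cdot> (g + id) = [s \<cdot> g, k]\<close>, the equation tying an action to a point passes to the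
  action restricted along \<open>g\<close>.
\<close>

lemma associated_action_restrict:
  assumes g: "g \<in> Hom C b c" and s: "s \<in> Hom C c a" and k: "k \<in> Hom C x a" and \<xi>: "\<xi> \<in> Hom C (flat C S c x) x"
    and k\<xi>: "k \<cdot> \<xi> = copair C S s k \<cdot> ker S c x"
  shows "k \<cdot> (\<xi> \<cdot> flat_map C S g (Idn C x)) = copair C S (s \<cdot> g) k \<cdot> ker S b x"
proof -
  have [simp]: "b \<in> Obj C" "c \<in> Obj C" "x \<in> Obj C" using Hom_obj[OF g] Hom_obj[OF k] by auto
  note [simp] = g[unfolded in_Hom] s[unfolded in_Hom] k[unfolded in_Hom] \<xi>[unfolded in_Hom]
  have f: "flat_map C S g (Idn C x) \<in> Hom C (flat C S b x) (flat C S c x)"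
    "ker S c x \<cdot> flat_map C S g (Idn C x) = cop_map C S g (Idn C x) \<cdot> ker S b x"
    using flat_map[of g "Idn C x"] by simp_all
  note [simp] = f(1)[unfolded in_Hom]
  have c: "copair C S s k \<cdot> cop_map C S g (Idn C x) = copair C S (s \<cdot> g) k"
    by (rule cop_ext[of _ b x a]) (simp_all add: in_Hom cop_map_def)
  show ?thesis
    using reassoc[OF k\<xi>, of "flat_map C S g (Idn C x)"] reassoc[OF c, of "ker S b x"] f(2) by simp
qed

end

section \<open>Ideal actions are coherent\<close>

locale chosen_ideally_exact_context =
  fixes UU :: "('o1, 'm1) cat" and VV :: "('o2, 'm2) cat"
    and F :: "('o2, 'm2, 'o1, 'm1) ftor" and U :: "('o1, 'm1, 'o2, 'm2) ftor"
    and \<eta> :: "'o2 \<Rightarrow> 'm2" and \<epsilon> :: "'o1 \<Rightarrow> 'm1"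
    and S :: "('o2, 'm2) choices"
  assumes ctx: "ideally_exact_context UU VV F U \<eta> \<epsilon>"
    and valid: "valid_choices VV S"

sublocale chosen_ideally_exact_context \<subseteq> U: category UU
  using ctx unfolding ideally_exact_context_def is_monadic_adjunction_def is_adjunction_def
  by unfold_locales simp

sublocale chosen_ideally_exact_context \<subseteq> V: semi_abelian_cat VV S
  using ctx valid
  unfolding ideally_exact_context_def is_monadic_adjunction_def is_adjunction_def
  by unfold_locales simp_all

context chosen_ideally_exact_context
begin

lemma adj: "is_adjunction UU VV F U \<eta> \<epsilon>"
  using ctx by (simp add: ideally_exact_context_def is_monadic_adjunction_def)

lemma F_ftor [simp]:
  "a \<in> Obj VV \<Longrightarrow> FO F a \<in> Obj UU" "a \<in> Obj VV \<Longrightarrow> FM F (Idn VV a) = Idn UU (FO F a)"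
  "f \<in> Arr VV \<Longrightarrow> FM F f \<in> Arr UU" "f \<in> Arr VV \<Longrightarrow> Dom UU (FM F f) = FO F (Dom VV f)"
  "f \<in> Arr VV \<Longrightarrow> Cod UU (FM F f) = FO F (Cod VV f)"
  "f \<in> Arr VV \<Longrightarrow> g \<in> Arr VV \<Longrightarrow> Cod VV f = Dom VV g \<Longrightarrow>
     FM F (g \<cdot>\<^bsub>VV\<^esub> f) = FM F g \<cdot>\<^bsub>UU\<^esub> FM F f"
  using adj by (simp_all add: is_adjunction_def is_ftor_def U.in_Hom)

lemma U_ftor [simp]:
  "b \<in> Obj UU \<Longrightarrow> FO U b \<in> Obj VV" "b \<in> Obj UU \<Longrightarrow> FM U (Idn UU b) = Idn VV (FO U b)"
  "f \<in> Arr UU \<Longrightarrow> FM U f \<in> Arr VV" "f \<in> Arr UU \<Longrightarrow> Dom VV (FM U f) = FO U (Dom UU f)"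
  "f \<in> Arr UU \<Longrightarrow> Cod VV (FM U f) = FO U (Cod UU f)"
  "f \<in> Arr UU \<Longrightarrow> g \<in> Arr UU \<Longrightarrow> Cod UU f = Dom UU g \<Longrightarrow>
     FM U (g \<cdot>\<^bsub>UU\<^esub> f) = FM U g \<cdot>\<^bsub>VV\<^esub> FM U f"
  using adj by (simp_all add: is_adjunction_def is_ftor_def V.in_Hom)

lemma unit [simp]:
  "x \<in> Obj VV \<Longrightarrow> \<eta> x \<in> Arr VV" "x \<in> Obj VV \<Longrightarrow> Dom VV (\<eta> x) = x"
  "x \<in> Obj VV \<Longrightarrow> Cod VV (\<eta> x) = FO U (FO F x)"
  and unit_natural: "f \<in> Arr VV \<Longrightarrow> FM U (FM F f) \<cdot>\<^bsub>VV\<^esub> \<eta> (Dom VV f) = \<eta> (Cod VV f) \<cdot>\<^bsub>VV\<^esub> f"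
  using adj by (simp_all add: is_adjunction_def is_nat_trans_def V.in_Hom id_ftor_def comp_ftor_def)

lemma counit [simp]:
  "b \<in> Obj UU \<Longrightarrow> \<epsilon> b \<in> Arr UU" "b \<in> Obj UU \<Longrightarrow> Dom UU (\<epsilon> b) = FO F (FO U b)"
  "b \<in> Obj UU \<Longrightarrow> Cod UU (\<epsilon> b) = b"
  and counit_natural: "f \<in> Arr UU \<Longrightarrow> f \<cdot>\<^bsub>UU\<^esub> \<epsilon> (Dom UU f) = \<epsilon> (Cod UU f) \<cdot>\<^bsub>UU\<^esub> FM F (FM U f)"
  using adj by (simp_all add: is_adjunction_def is_nat_trans_def U.in_Hom id_ftor_def comp_ftor_def)

lemma triangles:
  "x \<in> Obj VV \<Longrightarrow> \<epsilon> (FO F x) \<cdot>\<^bsub>UU\<^esub> FM F (\<eta> x) = Idn UU (FO F x)"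
  "b \<in> Obj UU \<Longrightarrow> FM U (\<epsilon> b) \<cdot>\<^bsub>VV\<^esub> \<eta> (FO U b) = Idn VV (FO U b)"
  using adj by (simp_all add: is_adjunction_def)

lemma transpose_transpose:
  assumes f: "f \<in> Hom UU (FO F x) b" and x [simp]: "x \<in> Obj VV"
  shows "\<epsilon> b \<cdot>\<^bsub>UU\<^esub> FM F (FM U f \<cdot>\<^bsub>VV\<^esub> \<eta> x) = f"
proof -
  note [simp] = f[unfolded U.in_Hom]
  have [simp]: "b \<in> Obj UU" using U.Hom_obj[OF f] by simp
  have n: "\<epsilon> b \<cdot>\<^bsub>UU\<^esub> FM F (FM U f) = f \<cdot>\<^bsub>UU\<^esub> \<epsilon> (FO F x)" using counit_natural[of f] by simp
  show ?thesis using U.reassoc[OF n, of "FM F (\<eta> x)"] triangles(1)[OF x] by simp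
qed

lemma transpose_unit:
  assumes k: "k \<in> Hom VV x (FO U b)" and b [simp]: "b \<in> Obj UU"
  shows "FM U (\<epsilon> b \<cdot>\<^bsub>UU\<^esub> FM F k) \<cdot>\<^bsub>VV\<^esub> \<eta> x = k"
proof -
  note [simp] = k[unfolded V.in_Hom]
  have [simp]: "x \<in> Obj VV" using V.Hom_obj[OF k] by simp
  have n: "FM U (FM F k) \<cdot>\<^bsub>VV\<^esub> \<eta> x = \<eta> (FO U b) \<cdot>\<^bsub>VV\<^esub> k" using unit_natural[of k] by simp
  show ?thesis using V.reassoc[OF triangles(2)[OF b], of k] n by simp
qed

text \<open>A left adjoint preserves initial objects: transposes of morphisms out of \<open>F 0\<close> start at \<open>0\<close>.\<close>

lemma F_zero_initial: "is_initial UU (FO F (zob S))"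
  unfolding is_initial_def
proof (intro conjI ballI)
  note [simp] = V.zob(3)
  show "FO F (zob S) \<in> Obj UU" by simp
  fix b assume b [simp]: "b \<in> Obj UU"
  have "the_mor VV (zob S) (FO U b) \<in> Hom VV (zob S) (FO U b)"
    by (rule V.the_mor_initial(1)[OF V.zob(1)]) simp
  then have ex: "\<epsilon> b \<cdot>\<^bsub>UU\<^esub> FM F (the_mor VV (zob S) (FO U b)) \<in> Hom UU (FO F (zob S)) b"
    by (simp add: U.in_Hom V.in_Hom)
  have un: "f = g" if f: "f \<in> Hom UU (FO F (zob S)) b" and g: "g \<in> Hom UU (FO F (zob S)) b" for f g
  proof -
    have "FM U f \<cdot>\<^bsub>VV\<^esub> \<eta> (zob S) = the_mor VV (zob S) (FO U b)"
      "FM U g \<cdot>\<^bsub>VV\<^esub> \<eta> (zob S) = the_mor VV (zob S) (FO U b)"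
      by (rule V.the_mor_initial(2)[OF V.zob(1)]; use f g in \<open>simp add: U.in_Hom V.in_Hom\<close>)+
    then show ?thesis using transpose_transpose[OF f] transpose_transpose[OF g] by simp
  qed
  show "\<exists>!f. f \<in> Hom UU (FO F (zob S)) b" using ex un by blast
qed

text \<open>
  The naturality square of the unit at \<open>X \<rightarrow> 0\<close> is a pullback, which makes \<open>\<eta> X\<close> a kernel of
  \<open>UF(X \<rightarrow> 0)\<close>; so the defining equation of \<open>\<xi>\<^sub>0\<close> has exactly one solution.
\<close>

lemma xi0:
  assumes X [simp]: "X \<in> Obj VV"
  shows "xi0 VV S F U \<eta> X \<in> Hom VV (flat VV S (FO U (FO F (zob S))) X) X"
    and "\<eta> X \<cdot>\<^bsub>VV\<^esub> xi0 VV S F U \<eta> X =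
      copair VV S (FM U (FM F (the_mor VV (zob S) X))) (\<eta> X) \<cdot>\<^bsub>VV\<^esub> ker S (FO U (FO F (zob S))) X"
proof -
  note [simp] = V.zob(3)
  define z where "z = zob S"
  define Z where "Z = FO U (FO F z)"
  define \<tau> where "\<tau> = zero_mor VV X z"
  define \<iota> where "\<iota> = the_mor VV z X"
  define m where "m = copair VV S (FM U (FM F \<iota>)) (\<eta> X) \<cdot>\<^bsub>VV\<^esub> ker S Z X"
  have [simp]: "z \<in> Obj VV" "Z \<in> Obj VV" by (simp_all add: z_def Z_def)
  have [simp]: "\<tau> \<in> Arr VV" "Dom VV \<tau> = X" "Cod VV \<tau> = z" by (simp_all add: \<tau>_def)
  have [simp]: "\<iota> \<in> Arr VV" "Dom VV \<iota> = z" "Cod VV \<iota> = X"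
    using V.the_mor_initial(1)[OF V.zob(1) X] by (simp_all add: \<iota>_def z_def V.in_Hom)
  have Zz: "FO U (FO F z) = Z" by (simp add: Z_def)
  have [simp]: "m \<in> Arr VV" "Dom VV m = flat VV S Z X" "Cod VV m = FO U (FO F X)"
    by (simp_all add: m_def Zz)
  have pb: "is_pullback VV (FM U (FM F \<tau>)) (\<eta> z) (\<eta> X) \<tau>"
  proof -
    have "\<forall>f\<in>Arr VV. is_pullback VV (FM U (FM F f)) (\<eta> (Cod VV f)) (\<eta> (Dom VV f)) f"
      using ctx unfolding ideally_exact_context_def by blast
    from bspec[OF this, of \<tau>] show ?thesis by simp
  qed
  have un_init: "f = g" if "f \<in> Hom VV z y" "g \<in> Hom VV z y" for f g y
    using V.zob(1) V.Hom_obj[OF that(1)] that unfolding z_def is_initial_def by blast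
  have un_term: "f = g" if "f \<in> Hom VV y z" "g \<in> Hom VV y z" for f g y
    using V.zob(2) V.Hom_obj[OF that(1)] that unfolding z_def is_terminal_def by blast
  have \<tau>\<iota>: "\<tau> \<cdot>\<^bsub>VV\<^esub> \<iota> = Idn VV z" by (rule un_init[of _ z]) (simp_all add: V.in_Hom)
  have "FM U (FM F \<tau>) \<cdot>\<^bsub>VV\<^esub> FM U (FM F \<iota>) = FM U (FM F (\<tau> \<cdot>\<^bsub>VV\<^esub> \<iota>))" by simp
  also have "\<dots> = Idn VV Z" unfolding \<tau>\<iota> by (simp add: Z_def)
  finally have a: "FM U (FM F \<tau>) \<cdot>\<^bsub>VV\<^esub> FM U (FM F \<iota>) = Idn VV Z" .
  have b: "FM U (FM F \<tau>) \<cdot>\<^bsub>VV\<^esub> \<eta> X = zero_mor VV X Z"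
    using V.pullback_arr(9)[OF pb] by (simp add: \<tau>_def Zz)
  have "FM U (FM F \<tau>) \<cdot>\<^bsub>VV\<^esub> copair VV S (FM U (FM F \<iota>)) (\<eta> X) = V.retraction Z X"
    by (subst V.cmp_copair[of _ Z "FO U (FO F X)" _ X _ Z]) (simp_all add: V.in_Hom a b Zz)
  from V.reassoc[OF this, of "ker S Z X"]
  have m0: "FM U (FM F \<tau>) \<cdot>\<^bsub>VV\<^esub> m = zero_mor VV (flat VV S Z X) Z"
    by (simp add: m_def Zz)
  have lift: "FM U (FM F \<tau>) \<cdot>\<^bsub>VV\<^esub> m = \<eta> z \<cdot>\<^bsub>VV\<^esub> zero_mor VV (flat VV S Z X) z"
    by (simp add: m0 Zz)
  obtain h where h: "h \<in> Hom VV (flat VV S Z X) (Dom VV (\<eta> X))" and \<eta>h: "\<eta> X \<cdot>\<^bsub>VV\<^esub> h = m"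
    by (rule V.pullback_lift[OF pb _ _ lift]) (assumption | simp (no_asm) add: V.in_Hom)+
  have "\<exists>!h. h \<in> Hom VV (flat VV S Z X) X \<and> \<eta> X \<cdot>\<^bsub>VV\<^esub> h = m"
  proof (rule ex1I[of _ h])
    show "h \<in> Hom VV (flat VV S Z X) X \<and> \<eta> X \<cdot>\<^bsub>VV\<^esub> h = m" using h \<eta>h by simp
    fix h' assume h': "h' \<in> Hom VV (flat VV S Z X) X \<and> \<eta> X \<cdot>\<^bsub>VV\<^esub> h' = m"
    have "\<tau> \<cdot>\<^bsub>VV\<^esub> h' = \<tau> \<cdot>\<^bsub>VV\<^esub> h"
      by (rule un_term[of _ "flat VV S Z X"]) (use h h' in \<open>simp_all add: V.in_Hom\<close>)
    then show "h' = h"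
      using V.pullback_unique[OF pb _ h, of h'] h' \<eta>h by simp
  qed
  from theI'[OF this]
  show "xi0 VV S F U \<eta> X \<in> Hom VV (flat VV S (FO U (FO F (zob S))) X) X"
    and "\<eta> X \<cdot>\<^bsub>VV\<^esub> xi0 VV S F U \<eta> X =
      copair VV S (FM U (FM F (the_mor VV (zob S) X))) (\<eta> X) \<cdot>\<^bsub>VV\<^esub> ker S (FO U (FO F (zob S))) X"
    unfolding m_def Z_def z_def \<iota>_def xi0_def[symmetric] by auto
qed

text \<open>
  Over a point \<open>p', s'\<close> that lives in \<open>UU\<close>, both sides of the coherence equation become
  \<open>[U(s' \<cdot> \<iota>\<^sub>B), k] \<cdot> \<kappa>\<close> after the monomorphism \<open>k\<close>: for \<open>\<xi>\<^sub>0\<close> by way of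
  the transpose of \<open>k\<close> and the initiality of \<open>F 0\<close>, for the restriction of \<open>\<xi>\<close> by the lemma on
  restricted actions.
\<close>

lemma coherent_if_associated_point_lifts:
  assumes pt: "is_point UU a B p' s'" and k: "k \<in> Hom VV X (FO U a)" "V.mono k"
    and \<xi>: "\<xi> \<in> Hom VV (flat VV S (FO U B) X) X"
    and k\<xi>: "k \<cdot>\<^bsub>VV\<^esub> \<xi> = copair VV S (FM U s') k \<cdot>\<^bsub>VV\<^esub> ker S (FO U B) X"
  shows "is_coherent UU VV S F U \<eta> B X \<xi>"
proof -
  note [simp] = V.zob(3) pt[unfolded U.point_iff] k(1)[unfolded V.in_Hom] \<xi>[unfolded V.in_Hom]
  have [simp]: "X \<in> Obj VV" "B \<in> Obj UU" "a \<in> Obj UU"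
    using V.Hom_obj[OF k(1)] U.arr_obj[of p'] by simp_all
  define Z where "Z = FO F (zob S)"
  define \<iota>B where "\<iota>B = the_mor UU Z B"
  define \<iota>X where "\<iota>X = the_mor VV (zob S) X"
  define f where "f = \<epsilon> a \<cdot>\<^bsub>UU\<^esub> FM F k"
  have [simp]: "Z \<in> Obj UU" by (simp add: Z_def)
  have [simp]: "\<iota>B \<in> Arr UU" "Dom UU \<iota>B = Z" "Cod UU \<iota>B = B"
    using U.the_mor_initial(1)[OF F_zero_initial, of B] by (simp_all add: \<iota>B_def Z_def U.in_Hom)
  have [simp]: "\<iota>X \<in> Arr VV" "Dom VV \<iota>X = zob S" "Cod VV \<iota>X = X"
    using V.the_mor_initial(1)[OF V.zob(1), of X] by (simp_all add: \<iota>X_def V.in_Hom)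
  have [simp]: "f \<in> Arr UU" "Dom UU f = FO F X" "Cod UU f = a" by (simp_all add: f_def)
  have Z0: "FO F (zob S) = Z" by (simp add: Z_def)
  have Uf\<eta>: "FM U f \<cdot>\<^bsub>VV\<^esub> \<eta> X = k" unfolding f_def by (rule transpose_unit) (use k in simp_all)
  note initial = U.the_mor_initial(2)[OF F_zero_initial[folded Z_def] \<open>a \<in> Obj UU\<close>]
  have "f \<cdot>\<^bsub>UU\<^esub> FM F \<iota>X = the_mor UU Z a" by (rule initial) (simp add: U.in_Hom Z0)
  also have "\<dots> = s' \<cdot>\<^bsub>UU\<^esub> \<iota>B" by (rule initial[symmetric]) (simp add: U.in_Hom)
  finally have "f \<cdot>\<^bsub>UU\<^esub> FM F \<iota>X = s' \<cdot>\<^bsub>UU\<^esub> \<iota>B" .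
  then have "FM U (f \<cdot>\<^bsub>UU\<^esub> FM F \<iota>X) = FM U (s' \<cdot>\<^bsub>UU\<^esub> \<iota>B)" by (rule arg_cong)
  then have UfF: "FM U f \<cdot>\<^bsub>VV\<^esub> FM U (FM F \<iota>X) = FM U s' \<cdot>\<^bsub>VV\<^esub> FM U \<iota>B" by (simp add: Z0)
  define x0 where "x0 = xi0 VV S F U \<eta> X"
  have x0: "x0 \<in> Hom VV (flat VV S (FO U Z) X) X"
    "\<eta> X \<cdot>\<^bsub>VV\<^esub> x0 = copair VV S (FM U (FM F \<iota>X)) (\<eta> X) \<cdot>\<^bsub>VV\<^esub> ker S (FO U Z) X"
    using xi0[of X] by (simp_all add: x0_def Z_def \<iota>X_def)
  note [simp] = x0(1)[unfolded V.in_Hom]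
  have c: "FM U f \<cdot>\<^bsub>VV\<^esub> copair VV S (FM U (FM F \<iota>X)) (\<eta> X) = copair VV S (FM U s' \<cdot>\<^bsub>VV\<^esub> FM U \<iota>B) k"
    by (subst V.cmp_copair[of _ "FO U Z" "FO U (FO F X)" _ X _ "FO U a"])
      (simp_all add: V.in_Hom UfF Uf\<eta> Z0)
  have "k \<cdot>\<^bsub>VV\<^esub> x0 = FM U f \<cdot>\<^bsub>VV\<^esub> (\<eta> X \<cdot>\<^bsub>VV\<^esub> x0)"
    using V.reassoc[OF Uf\<eta>, of x0] by simp
  also have "\<dots> = copair VV S (FM U s' \<cdot>\<^bsub>VV\<^esub> FM U \<iota>B) k \<cdot>\<^bsub>VV\<^esub> ker S (FO U Z) X"
    unfolding x0(2) using V.reassoc[OF c, of "ker S (FO U Z) X"] by (simp add: Z0)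
  also have "\<dots> = k \<cdot>\<^bsub>VV\<^esub> (\<xi> \<cdot>\<^bsub>VV\<^esub> flat_map VV S (FM U \<iota>B) (Idn VV X))"
    by (rule V.associated_action_restrict[symmetric, OF _ _ k(1) \<xi> k\<xi>]) (simp_all add: V.in_Hom)
  finally have eq: "k \<cdot>\<^bsub>VV\<^esub> x0 = k \<cdot>\<^bsub>VV\<^esub> (\<xi> \<cdot>\<^bsub>VV\<^esub> flat_map VV S (FM U \<iota>B) (Idn VV X))" .
  have fm: "flat_map VV S (FM U \<iota>B) (Idn VV X) \<in> Hom VV (flat VV S (FO U Z) X) (flat VV S (FO U B) X)"
    using V.flat_map(1)[of "FM U \<iota>B" "Idn VV X"] by simp
  have "x0 = \<xi> \<cdot>\<^bsub>VV\<^esub> flat_map VV S (FM U \<iota>B) (Idn VV X)"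
    by (rule V.monoD[OF k(2) eq, of "flat VV S (FO U Z) X"]) (use fm in \<open>simp_all add: V.in_Hom\<close>)
  then show ?thesis by (simp add: is_coherent_def x0_def \<iota>B_def Z_def)
qed

theorem ideal_action_coherent:
  assumes B [simp]: "B \<in> Obj UU" and act: "is_relative_action VV S U B X \<xi>"
    and ideal: "is_ideal_action UU VV S U B X \<xi>"
  shows "is_coherent UU VV S F U \<eta> B X \<xi>"
proof -
  have act': "is_internal_action VV S (FO U B) X \<xi>" using act by (simp add: is_relative_action_def)
  then have X [simp]: "X \<in> Obj VV" and \<xi>: "\<xi> \<in> Hom VV (flat VV S (FO U B) X) X"
    by (simp_all add: is_internal_action_def is_algebra_def flat_ftor_def)
  obtain a p s where as: "is_associated VV S (FO U B) X \<xi> a p s"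
    by (rule V.internal_action_has_associated_point[OF _ act']) simp_all
  then obtain k where s: "s \<in> Hom VV (FO U B) a" and k: "k \<in> Hom VV X a" "is_kernel VV k p"
    and k\<xi>: "k \<cdot>\<^bsub>VV\<^esub> \<xi> = copair VV S s k \<cdot>\<^bsub>VV\<^esub> ker S (FO U B) X"
    by (auto simp: is_associated_def is_point_def)
  have "is_ideal_split_epi UU VV U B a p s" using ideal as by (simp add: is_ideal_action_def)
  then obtain a' p' s' \<sigma> where pt: "is_point UU a' B p' s'" and \<sigma>: "\<sigma> \<in> Hom VV (FO U a') a" "is_iso VV \<sigma>"
    and \<sigma>s: "\<sigma> \<cdot>\<^bsub>VV\<^esub> FM U s' = s"
    by (auto simp: is_ideal_split_epi_def)
  note [simp] = \<xi>[unfolded V.in_Hom] s[unfolded V.in_Hom] k(1)[unfolded V.in_Hom] \<sigma>(1)[unfolded V.in_Hom]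
    pt[unfolded U.point_iff]
  obtain \<rho> where \<rho>: "\<rho> \<in> Hom VV a (FO U a')" and \<rho>\<sigma>: "\<rho> \<cdot>\<^bsub>VV\<^esub> \<sigma> = Idn VV (FO U a')"
    and \<sigma>\<rho>: "\<sigma> \<cdot>\<^bsub>VV\<^esub> \<rho> = Idn VV a"
    using \<sigma>(2) by (auto simp: is_iso_def)
  note [simp] = \<rho>[unfolded V.in_Hom]
  have a': "FO U a' \<in> Obj VV" using V.Hom_obj[OF \<rho>] by simp
  have \<rho>s: "\<rho> \<cdot>\<^bsub>VV\<^esub> s = FM U s'" using V.reassoc[OF \<rho>\<sigma>, of "FM U s'"] \<sigma>s a' by simp
  \<comment> \<open>The kernel is carried along \<open>\<sigma>\<close> to the point that lives in \<open>UU\<close>.\<close>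
  have "V.mono \<rho>" by (rule V.split_mono[OF \<rho> \<sigma>(1) \<sigma>\<rho>])
  then have mono: "V.mono (\<rho> \<cdot>\<^bsub>VV\<^esub> k)"
    using V.kernel_mono[OF k(2)] by (rule V.mono_cmp) simp
  have c: "\<rho> \<cdot>\<^bsub>VV\<^esub> copair VV S s k = copair VV S (FM U s') (\<rho> \<cdot>\<^bsub>VV\<^esub> k)"
    by (subst V.cmp_copair[OF s k(1) \<rho>]) (simp add: \<rho>s)
  show ?thesis
  proof (rule coherent_if_associated_point_lifts[OF pt _ mono \<xi>])
    show "(\<rho> \<cdot>\<^bsub>VV\<^esub> k) \<cdot>\<^bsub>VV\<^esub> \<xi> = copair VV S (FM U s') (\<rho> \<cdot>\<^bsub>VV\<^esub> k) \<cdot>\<^bsub>VV\<^esub> ker S (FO U B) X"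
      using V.reassoc[OF c, of "ker S (FO U B) X"] k\<xi> by simp
  qed (simp add: V.in_Hom)
qed

end

theorem theorem4p11:
  fixes UU :: "('o1, 'm1) cat" and VV :: "('o2, 'm2) cat"
    and F :: "('o2, 'm2, 'o1, 'm1) ftor" and U :: "('o1, 'm1, 'o2, 'm2) ftor"
    and \<eta> :: "'o2 \<Rightarrow> 'm2" and \<epsilon> :: "'o1 \<Rightarrow> 'm1"
    and S :: "('o2, 'm2) choices"
    and B :: 'o1 and X :: 'o2 and \<xi> :: 'm2
  assumes "ideally_exact_context UU VV F U \<eta> \<epsilon>"
    and "valid_choices VV S"
    and "B \<in> Obj UU"
    and "X \<in> Obj VV"
    and "is_relative_action VV S U B X \<xi>"
    and "is_ideal_action UU VV S U B X \<xi>"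
  shows "is_coherent UU VV S F U \<eta> B X \<xi>"
proof -
  interpret chosen_ideally_exact_context UU VV F U \<eta> \<epsilon> S
    using assms(1,2) by unfold_locales
  show ?thesis using ideal_action_coherent assms(3,5,6) .
qed

end
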